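(* Let $D\subset\mathbb C$ be a domain and let $n\geq 2$ be fixed. If $\#(\mathbb C\setminus D)\geq 2n$, then $S_n(D)$ is Kobayashi complete. If $\#(\mathbb C\setminus D)<2n$, then $S_n(D)$ contains a non-constant holomorphic image of $\mathbb C$ (i.e. there is a non-constant holomorphic map $\mathbb C\to S_n(D)$), and thus $S_n(D)$ is not Kobayashi hyperbolic.
   Context: $\#A$ is the number of elements of $A$ (possibly infinite). $\mathbb D$ is the open unit disc in $\mathbb C$ and $p$ is the Poincaré distance on $\mathbb D$ (so $p(0,\sigma)=\operatorname{artanh}|\sigma|$). $\pi_n:\mathbb C^n\to\mathbb C^n$ is the symmetrization map, $\pi_n(\lambda_1,\ldots,\lambda_n)=(\sigma_1(\lambda),\ldots,\sigma_n(\lambda))$, where $\sigma_j$ is the $j$-th elementary symmetric polynomial. For a domain $D\subset\mathbb C$, $S_n(D):=\pi_n(D^n)$, which is a domain in $\mathbb C^n$. For a domain $\Omega\subset\mathbb C^n$, the Lempert function is $l_\Omega(w,z)=\inf\{p(0,\sigma):\sigma\in\mathbb D,\ \exists f\in\mathcal O(\mathbb D,\Omega),\ f(0)=w,\ f(\sigma)=z\}$, and the Kobayashi pseudodistance $k_\Omega$ is the largest pseudodistance smaller than or equal to $l_\Omega$. $\Omega$ is Kobayashi hyperbolic if $k_\Omega$ is a distance; it is Kobayashi complete if it is Kobayashi hyperbolic and $(\Omega,k_\Omega)$ is a complete metric space. *)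

theory Defs
  imports "HOL-Complex_Analysis.Complex_Analysis"
begin

text \<open>
  Since the dimension \<open>n\<close> is a variable, \<open>\<complex>\<^sup>n\<close> is represented by the set
  \<open>{1..n} \<rightarrow>\<^sub>E UNIV\<close> of functions that are \<open>undefined\<close> outside \<open>{1..n}\<close>, so that equality
  of points is equality of coordinates.
\<close>

type_synonym cvec = "nat \<Rightarrow> complex"

definition elem_sym :: "nat \<Rightarrow> nat \<Rightarrow> cvec \<Rightarrow> complex" where
  "elem_sym n j l = (\<Sum>I | I \<subseteq> {1..n} \<and> card I = j. \<Prod>i\<in>I. l i)"

definition symmetrization :: "nat \<Rightarrow> cvec \<Rightarrow> cvec" where
  "symmetrization n l = (\<lambda>j\<in>{1..n}. elem_sym n j l)"

definition sym_product :: "nat \<Rightarrow> complex set \<Rightarrow> cvec set" where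
  "sym_product n D = symmetrization n ` ({1..n} \<rightarrow>\<^sub>E D)"

definition holomorphic_maps :: "nat \<Rightarrow> complex set \<Rightarrow> cvec set \<Rightarrow> (complex \<Rightarrow> cvec) set" where
  "holomorphic_maps n U \<Omega> =
     {f. (\<forall>z\<in>U. f z \<in> \<Omega>) \<and> (\<forall>j\<in>{1..n}. (\<lambda>z. f z j) holomorphic_on U)}"

definition poincare_dist :: "complex \<Rightarrow> complex \<Rightarrow> real" where
  "poincare_dist a b = artanh (cmod ((a - b) / (1 - cnj a * b)))"

text \<open>The value is extended real, so that an infimum over the empty set is \<open>\<infinity>\<close>.\<close>

definition lempert :: "nat \<Rightarrow> cvec set \<Rightarrow> cvec \<Rightarrow> cvec \<Rightarrow> ereal" where
  "lempert n \<Omega> w z =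
     (INF \<sigma> \<in> {\<sigma> \<in> ball 0 1. \<exists>f \<in> holomorphic_maps n (ball 0 1) \<Omega>. f 0 = w \<and> f \<sigma> = z}.
        ereal (poincare_dist 0 \<sigma>))"

text \<open>
  As in \<^locale>\<open>Metric_space\<close>, nonnegativity and symmetry are not relativised to the carrier.
  This is harmless: a pseudodistance on the carrier extends by \<open>0\<close>.
\<close>

definition pseudodistance_on :: "'a set \<Rightarrow> ('a \<Rightarrow> 'a \<Rightarrow> real) \<Rightarrow> bool" where
  "pseudodistance_on M d \<longleftrightarrow>
     (\<forall>x y. 0 \<le> d x y) \<and> (\<forall>x y. d x y = d y x) \<and> (\<forall>x\<in>M. d x x = 0) \<and>
     (\<forall>x\<in>M. \<forall>y\<in>M. \<forall>z\<in>M. d x z \<le> d x y + d y z)"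

definition below_lempert :: "nat \<Rightarrow> cvec set \<Rightarrow> (cvec \<Rightarrow> cvec \<Rightarrow> real) \<Rightarrow> bool" where
  "below_lempert n \<Omega> d \<longleftrightarrow>
     pseudodistance_on \<Omega> d \<and> (\<forall>w\<in>\<Omega>. \<forall>z\<in>\<Omega>. ereal (d w z) \<le> lempert n \<Omega> w z)"

definition is_kobayashi :: "nat \<Rightarrow> cvec set \<Rightarrow> (cvec \<Rightarrow> cvec \<Rightarrow> real) \<Rightarrow> bool" where
  "is_kobayashi n \<Omega> k \<longleftrightarrow>
     below_lempert n \<Omega> k \<and>
     (\<forall>d. below_lempert n \<Omega> d \<longrightarrow> (\<forall>w\<in>\<Omega>. \<forall>z\<in>\<Omega>. d w z \<le> k w z))"

text \<open>
  The choice is only about the irrelevant values outside \<open>\<Omega>\<close>, see the two lemmas below. The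
  boundedness assumption of the second one holds whenever any two points of \<open>\<Omega>\<close> are joined by
  a finite chain of analytic discs, in particular if \<open>\<Omega>\<close> is a domain.
\<close>

definition kobayashi :: "nat \<Rightarrow> cvec set \<Rightarrow> cvec \<Rightarrow> cvec \<Rightarrow> real" where
  "kobayashi n \<Omega> = (SOME k. is_kobayashi n \<Omega> k)"

lemma is_kobayashi_unique:
  assumes "is_kobayashi n \<Omega> k" "is_kobayashi n \<Omega> k'" "w \<in> \<Omega>" "z \<in> \<Omega>"
  shows "k w z = k' w z"
  using assms unfolding is_kobayashi_def by (meson order_antisym)

lemma is_kobayashi_kobayashi:
  assumes bounded: "\<And>w z. w \<in> \<Omega> \<Longrightarrow> z \<in> \<Omega> \<Longrightarrow> \<exists>B. \<forall>d. below_lempert n \<Omega> d \<longrightarrow> d w z \<le> B"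
  shows "is_kobayashi n \<Omega> (kobayashi n \<Omega>)"
proof -
  let ?F = "{d. below_lempert n \<Omega> d}"
  define k where "k w z = (if w \<in> \<Omega> \<and> z \<in> \<Omega> then SUP d\<in>?F. d w z else 0)" for w z
  have nonneg_dist: "0 \<le> poincare_dist 0 \<sigma>" if "\<sigma> \<in> ball 0 1" for \<sigma>
    using that by (simp add: poincare_dist_def artanh_def)
  have "below_lempert n \<Omega> (\<lambda>_ _. 0)"
    by (auto simp: below_lempert_def pseudodistance_on_def lempert_def nonneg_dist
        intro!: INF_greatest)
  then have zero: "(\<lambda>_ _. 0) \<in> ?F"
    by simp
  have bdd: "bdd_above ((\<lambda>d. d w z) ` ?F)" if "w \<in> \<Omega>" "z \<in> \<Omega>" for w z
    using bounded[OF that] by (auto simp: bdd_above_def)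
  have upper: "d w z \<le> k w z" if "d \<in> ?F" "w \<in> \<Omega>" "z \<in> \<Omega>" for d w z
    using cSUP_upper[OF that(1) bdd[OF that(2,3)]] that(2,3) by (simp add: k_def)
  have least: "k w z \<le> B" if "w \<in> \<Omega>" "z \<in> \<Omega>" "\<And>d. d \<in> ?F \<Longrightarrow> d w z \<le> B" for w z B
    using that zero by (auto simp: k_def intro!: cSUP_least)
  have "pseudodistance_on \<Omega> k"
    unfolding pseudodistance_on_def
  proof (intro conjI allI ballI)
    fix x y
    show "0 \<le> k x y"
      using upper[OF zero, of x y] by (cases "x \<in> \<Omega> \<and> y \<in> \<Omega>") (auto simp: k_def)
    have "d x y = d y x" if "d \<in> ?F" for d
      using that by (auto simp: below_lempert_def pseudodistance_on_def)
    then have "(SUP d\<in>?F. d x y) = (SUP d\<in>?F. d y x)"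
      by (rule SUP_cong[OF refl])
    then show "k x y = k y x"
      by (simp add: k_def)
  next
    fix x assume "x \<in> \<Omega>"
    then have "k x x \<le> 0"
      by (intro least) (auto simp: below_lempert_def pseudodistance_on_def)
    then show "k x x = 0"
      using upper[OF zero \<open>x \<in> \<Omega>\<close> \<open>x \<in> \<Omega>\<close>] by simp
  next
    fix x y z assume xyz: "x \<in> \<Omega>" "y \<in> \<Omega>" "z \<in> \<Omega>"
    show "k x z \<le> k x y + k y z"
    proof (rule least)
      fix d assume d: "d \<in> ?F"
      then have "d x z \<le> d x y + d y z"
        using xyz by (auto simp: below_lempert_def pseudodistance_on_def)
      also have "\<dots> \<le> k x y + k y z"
        using upper[OF d] xyz by (intro add_mono) auto
      finally show "d x z \<le> k x y + k y z" .
    qed (use xyz in auto)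
  qed
  moreover have "ereal (k w z) \<le> lempert n \<Omega> w z" if wz: "w \<in> \<Omega>" "z \<in> \<Omega>" for w z
  proof (cases "lempert n \<Omega> w z")
    case (real r)
    have "k w z \<le> r"
      using wz real by (intro least) (force simp: below_lempert_def)+
    with real show ?thesis by simp
  next
    case MInf
    have "ereal 0 \<le> lempert n \<Omega> w z"
      using zero wz unfolding below_lempert_def by blast
    with MInf show ?thesis by simp
  qed simp
  ultimately have "is_kobayashi n \<Omega> k"
    using upper by (auto simp: is_kobayashi_def below_lempert_def)
  then show ?thesis
    unfolding kobayashi_def by (rule someI[of "is_kobayashi n \<Omega>"])
qed

definition kobayashi_hyperbolic :: "nat \<Rightarrow> cvec set \<Rightarrow> bool" where
  "kobayashi_hyperbolic n \<Omega> \<longleftrightarrow> Metric_space \<Omega> (kobayashi n \<Omega>)"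

definition kobayashi_complete :: "nat \<Rightarrow> cvec set \<Rightarrow> bool" where
  "kobayashi_complete n \<Omega> \<longleftrightarrow>
     kobayashi_hyperbolic n \<Omega> \<and> Metric_space.mcomplete \<Omega> (kobayashi n \<Omega>)"

end

theory Submission
  imports Defs "HOL-Computational_Algebra.Fundamental_Theorem_Algebra"
begin

text \<open>
  A point \<open>z\<close> of \<open>\<complex>\<^sup>n\<close> is the coefficient vector of a monic polynomial \<open>P\<^sub>z\<close> of degree \<open>n\<close>, and it lies in
  \<open>S\<^sub>n(D)\<close> iff \<open>P\<^sub>z\<close> has no zero outside \<open>D\<close>. An analytic disc in \<open>S\<^sub>n(D)\<close> thus yields for each of
  \<open>2 n\<close> points outside \<open>D\<close> a holomorphic function without zeros. Together with the constant \<open>1\<close>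
  (the leading coefficient) these are \<open>2 n + 1\<close> functions, any \<open>n + 1\<close> of which span all of them by
  Lagrange interpolation.

  Let \<open>u\<close> be the maximum of the logarithms \<open>u\<^sub>j\<close> of their moduli. The key estimate, in the spirit of
  Eremenko's proof of Picard type theorems, is that \<open>u\<close> exceeds any \<open>u\<^sub>i\<close> that attains the maximum
  at \<open>0\<close> only by a universal constant on a fixed smaller disc. Otherwise one rescales at a finest
  scale at which the excess is large, and divides by the excess. By Harnack, Montel and Hurwitz the
  exponentials of the rescaled functions converge to functions that vanish identically or nowhere,
  any \<open>n + 1\<close> of which have the same maximal modulus. At every point at least \<open>n + 1\<close> of the
  \<open>2 n + 1\<close> moduli are maximal, so any two points have a maximal index in common, and one function
  is maximal everywhere; by the maximum principle it is constant, which contradicts the excess.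

  The key estimate gives Lipschitz bounds for the logarithm of \<open>U = 1 + max\<^sub>j \<bar>u\<^sub>j\<bar>\<close> and for
  \<open>P\<^sub>z(a) exp (- 2 U)\<close>, whence pseudodistances below the Lempert function for which Cauchy sequences
  converge inside \<open>S\<^sub>n(D)\<close>.

  If fewer than \<open>2 n\<close> points are missing, they are covered by disjoint sets \<open>B\<close> and \<open>B'\<close> with \<open>n\<close>
  and \<open>n - 1\<close> elements, and \<open>q + exp \<zeta> q'\<close> is an entire curve, where \<open>q\<close> and \<open>q'\<close> are the
  monic polynomials with simple zeros at \<open>B\<close> and \<open>B'\<close>.
\<close>

subsection \<open>Harnack inequalities\<close>

text \<open>Schwarz lemma for the Cayley transform that sends the right half plane to the unit disc
  and \<open>h a\<close> to \<open>0\<close>. Controlling \<open>h\<close> itself, not just its real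
  part, yields Lipschitz bounds for logarithms later.\<close>

lemma Harnack_cmod:
  fixes h :: "complex \<Rightarrow> complex"
  assumes hol: "h holomorphic_on ball a r"
    and pos: "\<And>z. z \<in> ball a r \<Longrightarrow> 0 < Re (h z)" and w: "w \<in> ball a r"
  shows "cmod (h w - h a) * (r - dist a w) \<le> 2 * dist a w * Re (h a)"
proof -
  have r: "0 < r" using w by (metis ball_eq_empty empty_iff not_le)
  have mem: "a + of_real r * \<zeta> \<in> ball a r" if "norm \<zeta> < 1" for \<zeta>
    using that r by (simp add: dist_norm norm_mult)
  have posa: "0 < Re (h a)" by (rule pos) (use r in simp)
  have den: "h z + cnj (h a) \<noteq> 0" if "z \<in> ball a r" for z
  proof
    assume "h z + cnj (h a) = 0"
    then have "Re (h z) + Re (h a) = 0" by (simp add: complex_eq_iff)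
    then show False using pos[OF that] posa by simp
  qed
  have less: "cmod (h z - h a) < cmod (h z + cnj (h a))" if "z \<in> ball a r" for z
  proof -
    have "(cmod (h z + cnj (h a)))\<^sup>2 - (cmod (h z - h a))\<^sup>2 = 4 * Re (h z) * Re (h a)"
      unfolding cmod_power2 by (simp add: algebra_simps power2_eq_square)
    then have "(cmod (h z - h a))\<^sup>2 < (cmod (h z + cnj (h a)))\<^sup>2"
      using pos[OF that] posa by (smt (verit) mult_pos_pos)
    then show ?thesis by (rule power_less_imp_less_base) simp
  qed
  define q where "q \<zeta> = (h (a + of_real r * \<zeta>) - h a) / (h (a + of_real r * \<zeta>) + cnj (h a))" for \<zeta>
  have holh: "(\<lambda>\<zeta>. h (a + of_real r * \<zeta>)) holomorphic_on ball 0 1"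
    by (rule holomorphic_on_compose_gen[OF _ hol, unfolded o_def])
       (auto intro!: holomorphic_intros mem simp del: mem_ball simp: mem_ball[of 0])
  have holq: "q holomorphic_on ball 0 1"
    unfolding q_def using den mem by (intro holomorphic_intros holh) auto
  have "norm (q \<zeta>) < 1" if "norm \<zeta> < 1" for \<zeta>
    using less[OF mem[OF that]] den[OF mem[OF that]] by (simp add: q_def norm_divide)
  moreover have "q 0 = 0" by (simp add: q_def)
  ultimately have schw: "norm (q \<zeta>) \<le> norm \<zeta>" if "norm \<zeta> < 1" for \<zeta>
    using Schwarz_Lemma(1)[OF holq] that by blast
  define s where "s = dist a w"
  have sr: "s < r" "0 \<le> s" using w by (auto simp: s_def)
  let ?t = "(w - a) / of_real r"
  have nt: "norm ?t = s / r" using r by (simp add: norm_divide s_def dist_norm norm_minus_commute)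
  have wt: "a + of_real r * ?t = w" using r by simp
  have "norm (q ?t) \<le> s / r" using schw[of ?t] nt sr r by simp
  then have "cmod (h w - h a) / cmod (h w + cnj (h a)) \<le> s / r"
    unfolding q_def wt by (simp add: norm_divide)
  then have 1: "cmod (h w - h a) * r \<le> s * cmod (h w + cnj (h a))"
    using den[OF w] r by (simp add: field_simps)
  have "cmod (h a + cnj (h a)) = 2 * Re (h a)"
    using posa by (simp add: complex_add_cnj)
  \<comment> \<open>The term \<open>cmod (h w - h a)\<close> is then moved to the left, which turns
    the factor \<open>r\<close> into \<open>r - s\<close>.\<close>
  then have "cmod (h w + cnj (h a)) \<le> cmod (h w - h a) + 2 * Re (h a)"
    using norm_triangle_ineq[of "h w - h a" "h a + cnj (h a)"] by simp
  then have "s * cmod (h w + cnj (h a)) \<le> s * (cmod (h w - h a) + 2 * Re (h a))"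
    using sr by (intro mult_left_mono)
  with 1 show ?thesis by (simp add: s_def algebra_simps)
qed

text \<open>The first bound gives the final Lipschitz estimate, the second propagates upper bounds
  from disc to disc.\<close>

lemma Harnack_half:
  assumes "h holomorphic_on ball a r"
    and "\<And>z. z \<in> ball a r \<Longrightarrow> 0 < Re (h z)" and w: "dist a w \<le> r / 2" and "0 < r"
  shows "cmod (h w - h a) * r \<le> 4 * dist a w * Re (h a)" "Re (h w) \<le> 3 * Re (h a)"
proof -
  have wb: "w \<in> ball a r" using w \<open>0 < r\<close> by simp
  have 1: "cmod (h w - h a) * (r - dist a w) \<le> 2 * dist a w * Re (h a)"
    by (rule Harnack_cmod) (use assms wb in auto)
  have "cmod (h w - h a) * (r / 2) \<le> cmod (h w - h a) * (r - dist a w)"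
    using w by (intro mult_left_mono) auto
  with 1 show 2: "cmod (h w - h a) * r \<le> 4 * dist a w * Re (h a)" by simp
  have "4 * dist a w * Re (h a) \<le> 2 * r * Re (h a)"
    using w assms(2)[of a] \<open>0 < r\<close> by (intro mult_right_mono) auto
  with 2 have "cmod (h w - h a) * r \<le> (2 * Re (h a)) * r" by (simp add: mult_ac)
  then have "cmod (h w - h a) \<le> 2 * Re (h a)" using \<open>0 < r\<close> by simp
  moreover have "Re (h w) - Re (h a) \<le> cmod (h w - h a)"
    using complex_Re_le_cmod[of "h w - h a"] by simp
  ultimately show "Re (h w) \<le> 3 * Re (h a)" by linarith
qed

subsection \<open>Families of nonvanishing functions\<close>

text \<open>The quotient has modulus 1 on \<open>W\<close>, so the maximum principle makes it
  constant. Vanishing identically is allowed because limits of zero-free functions may be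
  zero.\<close>

lemma cmod_eq_on_open_imp_eq:
  fixes f g :: "complex \<Rightarrow> complex"
  assumes S: "open S" "connected S" and hol: "f holomorphic_on S" "g holomorphic_on S"
    and f: "(\<forall>z\<in>S. f z = 0) \<or> (\<forall>z\<in>S. f z \<noteq> 0)" and g: "(\<forall>z\<in>S. g z = 0) \<or> (\<forall>z\<in>S. g z \<noteq> 0)"
    and W: "open W" "W \<noteq> {}" "W \<subseteq> S" and eq: "\<And>z. z \<in> W \<Longrightarrow> cmod (f z) = cmod (g z)"
    and z: "z \<in> S"
  shows "cmod (f z) = cmod (g z)"
proof -
  obtain x where x: "x \<in> W" "x \<in> S" using W by blast
  show ?thesis
  proof (cases "g x = 0")
    case True
    then have "f x = 0" using eq[OF x(1)] by simp
    with True f g x z show ?thesis by auto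
  next
    case False
    then have gnz: "\<And>z. z \<in> S \<Longrightarrow> g z \<noteq> 0" using g x by auto
    have quot: "(\<lambda>z. f z / g z) holomorphic_on S" using gnz by (intro holomorphic_intros hol)
    have one: "cmod (f z / g z) = 1" if "z \<in> W" for z
      using eq[OF that] gnz W that by (auto simp: norm_divide)
    have "(\<lambda>z. f z / g z) constant_on S"
      by (rule maximum_modulus_principle[OF quot S W(1) W(3) x(1)]) (use one x in auto)
    then have "f z / g z = f x / g x" using z x by (auto simp: constant_on_def)
    then have "cmod (f z / g z) = 1" using one[OF x(1)] by simp
    then show ?thesis using gnz[OF z] by (simp add: norm_divide)
  qed
qed

text \<open>Removes nowhere dense sets one at a time; they will be the loci where two moduli agree
  without agreeing on all of \<open>S\<close>.\<close>

lemma open_avoiding_finite: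
  assumes "finite P"
    and step: "\<And>Z W. Z \<in> P \<Longrightarrow> open W \<Longrightarrow> W \<noteq> {} \<Longrightarrow> W \<subseteq> S \<Longrightarrow> open (W - Z) \<and> W - Z \<noteq> {}"
    and "open W" "W \<noteq> {}" "W \<subseteq> S"
  shows "\<exists>W'. open W' \<and> W' \<noteq> {} \<and> W' \<subseteq> W \<and> W' \<inter> \<Union>P = {}"
  using assms
proof (induction P arbitrary: W rule: finite_induct)
  case empty
  then show ?case by auto
next
  case (insert Z P)
  have *: "open (W - Z)" "W - Z \<noteq> {}" "W - Z \<subseteq> S"
    using insert.prems(1)[of Z W] insert.prems by auto
  obtain W' where "open W'" "W' \<noteq> {}" "W' \<subseteq> W - Z" "W' \<inter> \<Union>P = {}"
    using insert.IH[OF _ *] insert.prems(1) by blast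
  then show ?case by (intro exI[of _ W']) blast
qed

lemma finite_argmax_exists:
  fixes f :: "'a \<Rightarrow> 'b::linorder"
  assumes "finite J" "J \<noteq> {}"
  shows "\<exists>i\<in>J. \<forall>j\<in>J. f j \<le> f i"
proof -
  have "Max (f ` J) \<in> f ` J" using assms by (intro Max_in) auto
  then show ?thesis using assms by (metis (no_types, lifting) Max_ge finite_imageI image_eqI image_iff)
qed

text \<open>
  Off a nowhere dense set, functions of equal modulus at a point have equal modulus everywhere.
  At each point at least \<open>n + 1\<close> of the \<open>2 n + 1\<close> moduli are maximal, so the sets of maximal
  indices at any two points intersect.
\<close>

lemma dominant_function:
  fixes F :: "'a \<Rightarrow> complex \<Rightarrow> complex"
  assumes S: "open S" "connected S" "S \<noteq> {}" and J: "finite J" "card J = 2 * n + 1"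
    and hol: "\<And>j. j \<in> J \<Longrightarrow> F j holomorphic_on S"
    and nz: "\<And>j. j \<in> J \<Longrightarrow> (\<forall>z\<in>S. F j z = 0) \<or> (\<forall>z\<in>S. F j z \<noteq> 0)"
    and dom: "\<And>z I j. z \<in> S \<Longrightarrow> I \<subseteq> J \<Longrightarrow> card I = n + 1 \<Longrightarrow> j \<in> J \<Longrightarrow>
                 \<exists>i\<in>I. cmod (F j z) \<le> cmod (F i z)"
  obtains k where "k \<in> J" "\<And>z j. z \<in> S \<Longrightarrow> j \<in> J \<Longrightarrow> cmod (F j z) \<le> cmod (F k z)"
proof -
  define same where "same i j \<longleftrightarrow> (\<forall>z\<in>S. cmod (F i z) = cmod (F j z))" for i j
  define Z where "Z i j = {z \<in> S. cmod (F i z) = cmod (F j z)}" for i j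
  define P where "P = (\<lambda>(i, j). Z i j) ` {(i, j) \<in> J \<times> J. \<not> same i j}"
  have "{(i, j) \<in> J \<times> J. \<not> same i j} \<subseteq> J \<times> J" by auto
  then have finP: "finite P" unfolding P_def using J(1) by (meson finite_SigmaI finite_imageI finite_subset)
  have stepP: "open (W - Q) \<and> W - Q \<noteq> {}" if Q: "Q \<in> P" and W: "open W" "W \<noteq> {}" "W \<subseteq> S" for Q W
  proof -
    obtain i j where ij: "i \<in> J" "j \<in> J" "\<not> same i j" "Q = Z i j" using Q by (auto simp: P_def)
    have cont: "continuous_on W (\<lambda>z. cmod (F i z) - cmod (F j z))"
      using hol ij W(3)
      by (intro continuous_intros holomorphic_on_imp_continuous_on) (auto intro: holomorphic_on_subset)
    have eq: "W - Q = W \<inter> (\<lambda>z. cmod (F i z) - cmod (F j z)) -` (- {0})"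
      using W(3) by (auto simp: ij Z_def)
    have "open (W - Q)" unfolding eq
      by (rule continuous_open_preimage[OF cont W(1)]) auto
    moreover have "W - Q \<noteq> {}"
    proof
      assume "W - Q = {}"
      then have "\<And>z. z \<in> W \<Longrightarrow> cmod (F i z) = cmod (F j z)" by (auto simp: ij Z_def)
      then have "same i j" unfolding same_def
        using cmod_eq_on_open_imp_eq[OF S(1,2) hol hol nz nz W, of i j] ij by blast
      with ij show False by simp
    qed
    ultimately show ?thesis by simp
  qed
  have dense: "\<exists>W'. open W' \<and> W' \<noteq> {} \<and> W' \<subseteq> W \<and> W' \<inter> \<Union>P = {}"
    if "open W" "W \<noteq> {}" "W \<subseteq> S" for W
    by (rule open_avoiding_finite[OF finP stepP that])
  define T where "T z = {i \<in> J. \<forall>j\<in>J. cmod (F j z) \<le> cmod (F i z)}" for z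
  have TJ: "T z \<subseteq> J" for z by (auto simp: T_def)
  have Tne: "T z \<noteq> {}" for z
  proof -
    have "J \<noteq> {}" using J by auto
    then obtain i where "i \<in> J" "\<And>j. j \<in> J \<Longrightarrow> cmod (F j z) \<le> cmod (F i z)"
      using finite_argmax_exists[of J "\<lambda>i. cmod (F i z)"] J(1) by blast
    then show ?thesis by (auto simp: T_def)
  qed
  \<comment> \<open>Otherwise there are \<open>n + 1\<close> non-maximal indices, and
    \<open>dom\<close> makes one of them at least as large as a maximal one.\<close>
  have Tcard: "n + 1 \<le> card (T z)" if z: "z \<in> S" for z
  proof (rule ccontr)
    assume "\<not> n + 1 \<le> card (T z)"
    then have "n + 1 \<le> card (J - T z)"
      using card_Diff_subset[OF finite_subset[OF TJ J(1)] TJ] J by simp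
    then obtain I where I: "I \<subseteq> J - T z" "card I = n + 1"
      by (metis obtain_subset_with_card_n)
    obtain j where j: "j \<in> T z" using Tne by blast
    then obtain i where i: "i \<in> I" "cmod (F j z) \<le> cmod (F i z)"
      using dom[OF z _ I(2)] I(1) TJ by blast
    then have "i \<in> T z" using j I(1) by (auto simp: T_def intro: order_trans)
    with i I show False by blast
  qed
  have inter: "T x \<inter> T y \<noteq> {}" if "x \<in> S" "y \<in> S" for x y
  proof
    assume "T x \<inter> T y = {}"
    then have "card (T x \<union> T y) = card (T x) + card (T y)"
      using finite_subset[OF TJ J(1)] by (intro card_Un_disjoint) auto
    moreover have "card (T x \<union> T y) \<le> card J" using TJ by (intro card_mono J) auto
    ultimately show False using Tcard[OF that(1)] Tcard[OF that(2)] J by linarith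
  qed
  have same_T: "same i j" if "y \<in> S" "y \<notin> \<Union>P" "i \<in> T y" "j \<in> T y" for i j y
  proof (rule ccontr)
    assume "\<not> same i j"
    then have "Z i j \<in> P" using that TJ unfolding P_def by blast
    moreover have "y \<in> Z i j" using that by (auto simp: Z_def T_def intro: order_antisym)
    ultimately show False using that by blast
  qed
  \<comment> \<open>The index \<open>k\<close> is read off at one generic point \<open>x\<close>. At
    another generic \<open>y\<close>, an index common to \<open>T x\<close> and \<open>T y\<close>
    has the same modulus as \<open>k\<close> on all of \<open>S\<close>, so \<open>k\<close> is
    maximal at \<open>y\<close> too.\<close>
  obtain x where x: "x \<in> S" "x \<notin> \<Union>P" using dense[OF S(1) S(3)] by blast
  obtain k where k: "k \<in> T x" using Tne by blast
  have good: "cmod (F j y) \<le> cmod (F k y)" if y: "y \<in> S" "y \<notin> \<Union>P" and "j \<in> J" for j y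
  proof -
    obtain m where m: "m \<in> T x" "m \<in> T y" using inter[OF x(1) y(1)] by blast
    have "same k m" using same_T[OF x k m(1)] .
    then have "cmod (F k y) = cmod (F m y)" using y by (auto simp: same_def)
    then show ?thesis using m(2) \<open>j \<in> J\<close> by (auto simp: T_def)
  qed
  have kJ: "k \<in> J" using k TJ by blast
  have "cmod (F j z) \<le> cmod (F k z)" if z: "z \<in> S" and j: "j \<in> J" for z j
  proof (rule ccontr)
    assume neg: "\<not> ?thesis"
    define W where "W = S \<inter> (\<lambda>z. cmod (F j z) - cmod (F k z)) -` {0<..}"
    have "continuous_on S (\<lambda>z. cmod (F j z) - cmod (F k z))"
      using hol j kJ by (intro continuous_intros holomorphic_on_imp_continuous_on)
    then have "open W" unfolding W_def by (rule continuous_open_preimage) (use S in auto)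
    moreover have "W \<noteq> {}" "W \<subseteq> S" using neg z by (auto simp: W_def)
    ultimately obtain W' where "W' \<noteq> {}" "W' \<subseteq> W" "W' \<inter> \<Union>P = {}" using dense by metis
    then obtain y where "y \<in> W" "y \<notin> \<Union>P" by blast
    then show False using good[of y j] j by (auto simp: W_def)
  qed
  with kJ show ?thesis using that by blast
qed

lemma Montel_finite_family:
  fixes F :: "nat \<Rightarrow> 'a \<Rightarrow> complex \<Rightarrow> complex"
  assumes "finite J" and S: "open S"
    and hol: "\<And>k j. j \<in> J \<Longrightarrow> F k j holomorphic_on S"
    and bd: "\<And>k j z. j \<in> J \<Longrightarrow> z \<in> S \<Longrightarrow> cmod (F k j z) \<le> B"
  shows "\<exists>G r. strict_mono (r :: nat \<Rightarrow> nat) \<and> (\<forall>j\<in>J. G j holomorphic_on S \<and>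
           (\<forall>K. compact K \<longrightarrow> K \<subseteq> S \<longrightarrow> uniform_limit K (\<lambda>k. F (r k) j) (G j) sequentially))"
  using assms(1) hol bd
proof (induction J rule: finite_induct)
  case empty
  then show ?case by (intro exI[of _ id] exI) (auto intro: strict_mono_id)
next
  case (insert i J)
  obtain G r where r: "strict_mono (r :: nat \<Rightarrow> nat)" and G: "\<And>j. j \<in> J \<Longrightarrow> G j holomorphic_on S"
    "\<And>j K. j \<in> J \<Longrightarrow> compact K \<Longrightarrow> K \<subseteq> S \<Longrightarrow> uniform_limit K (\<lambda>k. F (r k) j) (G j) sequentially"
    using insert by (metis insert_iff)
  obtain g r' where g: "g holomorphic_on S" "strict_mono (r' :: nat \<Rightarrow> nat)"
    "\<And>K. \<lbrakk>compact K; K \<subseteq> S\<rbrakk> \<Longrightarrow> uniform_limit K ((\<lambda>k. F (r k) i) \<circ> r') g sequentially"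
  proof (rule Montel[of S "range (\<lambda>k. F (r k) i)" "\<lambda>k. F (r k) i"])
    show "\<exists>B. \<forall>h\<in>range (\<lambda>k. F (r k) i). \<forall>z\<in>K. cmod (h z) \<le> B" if "K \<subseteq> S" for K
      using insert.prems(2)[of i] that by blast
  qed (use S insert.prems(1) in auto)
  have sub: "uniform_limit K (\<lambda>k. F (r (r' k)) j) (G j) sequentially"
    if "j \<in> J" "compact K" "K \<subseteq> S" for j K
    using filterlim_compose[OF G(2)[OF that, unfolded] filterlim_subseq[OF g(2)]] by (simp add: o_def)
  show ?case
  proof (intro exI conjI ballI allI impI)
    show "strict_mono (r \<circ> r')" by (rule strict_mono_o[OF r g(2)])
    fix j assume j: "j \<in> insert i J"
    show "(G(i := g)) j holomorphic_on S" using j g G by auto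
    fix K :: "complex set" assume "compact K" "K \<subseteq> S"
    then show "uniform_limit K (\<lambda>k. F ((r \<circ> r') k) j) ((G(i := g)) j) sequentially"
      using j g(3) sub by (auto simp: o_def)
  qed
qed

subsection \<open>The rescaling argument\<close>

text \<open>
  The functions \<open>L j\<close> are logarithms of units: any \<open>n + 1\<close> of the units control all the others.
\<close>

definition dominated_family :: "nat \<Rightarrow> 'a set \<Rightarrow> complex set \<Rightarrow> real \<Rightarrow> ('a \<Rightarrow> complex \<Rightarrow> complex) \<Rightarrow> bool" where
  "dominated_family n J S C L \<longleftrightarrow> (\<forall>j\<in>J. L j holomorphic_on S) \<and>
     (\<forall>z\<in>S. \<forall>I\<subseteq>J. card I = n + 1 \<longrightarrow> (\<forall>j\<in>J. \<exists>i\<in>I. Re (L j z) \<le> Re (L i z) + C))"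

definition top_index :: "'a set \<Rightarrow> ('a \<Rightarrow> complex \<Rightarrow> complex) \<Rightarrow> complex \<Rightarrow> 'a \<Rightarrow> bool" where
  "top_index J L z i \<longleftrightarrow> i \<in> J \<and> (\<forall>j\<in>J. Re (L j z) \<le> Re (L i z))"

lemma top_index_exists: "finite J \<Longrightarrow> J \<noteq> {} \<Longrightarrow> \<exists>i. top_index J L z i"
  using finite_argmax_exists[of J "\<lambda>i. Re (L i z)"] by (auto simp: top_index_def)

text \<open>
  Among the scales \<open>2\<^sup>-\<^sup>m / 8\<close> at which some top function is exceeded by \<open>K\<close>, with centres
  kept in a slightly larger disc at each step, continuity leaves a finest one.
\<close>

lemma critical_scale:
  assumes J: "finite J" and hol: "\<And>j. j \<in> J \<Longrightarrow> L j holomorphic_on ball 0 1" and K: "0 < K"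
    and start: "top_index J L 0 i" "j \<in> J" "norm w \<le> 1/8" "K \<le> Re (L j w) - Re (L i w)"
  obtains z r i j w where "0 < r" "norm z + 3 * r < 1" "top_index J L z i" "j \<in> J" "dist z w \<le> r"
    "K \<le> Re (L j w) - Re (L i w)"
    "\<And>z' i j w. dist z z' \<le> 2 * r \<Longrightarrow> top_index J L z' i \<Longrightarrow> j \<in> J \<Longrightarrow> dist z' w \<le> r / 2 \<Longrightarrow>
       Re (L j w) - Re (L i w) < K"
proof -
  \<comment> \<open>With \<open>r = (1/2)^m / 8\<close> the centre lies in the disc of radius
    \<open>1/2 - 4 * r\<close>. Passing to \<open>Suc m\<close> enlarges this radius by
    \<open>2 * r\<close>, exactly the displacement allowed in the conclusion.\<close>
  define P where "P m z \<longleftrightarrow> norm z \<le> 1/2 - (1/2)^m / 2 \<and>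
     (\<exists>i j w. top_index J L z i \<and> j \<in> J \<and> dist z w \<le> (1/2)^m / 8 \<and> K \<le> Re (L j w) - Re (L i w))"
    for m :: nat and z
  have P0: "P 0 0" using start by (auto simp: P_def)
  have "\<exists>d>0. \<forall>j\<in>J. \<forall>x\<in>cball 0 (3/4). \<forall>y\<in>cball 0 (3/4). dist y x < d \<longrightarrow> \<bar>Re (L j y) - Re (L j x)\<bar> < K / 2"
    using J hol
  proof (induction J rule: finite_induct)
    case empty
    then show ?case by (auto intro: exI[of _ 1])
  next
    case (insert i J)
    then obtain d where d: "d > 0" "\<forall>j\<in>J. \<forall>x\<in>cball 0 (3/4). \<forall>y\<in>cball 0 (3/4). dist y x < d \<longrightarrow> \<bar>Re (L j y) - Re (L j x)\<bar> < K / 2"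
      by blast
    have "L i holomorphic_on cball 0 (3/4)" using insert.prems by (rule holomorphic_on_subset) auto
    then have "uniformly_continuous_on (cball 0 (3/4)) (\<lambda>z. Re (L i z))"
      by (intro compact_uniformly_continuous continuous_intros holomorphic_on_imp_continuous_on) auto
    then obtain e where e: "e > 0" "\<forall>x\<in>cball 0 (3/4). \<forall>y\<in>cball 0 (3/4). dist y x < e \<longrightarrow> \<bar>Re (L i y) - Re (L i x)\<bar> < K / 2"
      unfolding uniformly_continuous_on_def dist_real_def using K by (meson half_gt_zero)
    show ?case
      by (rule exI[of _ "min d e"]) (use d e in auto)
  qed
  then obtain d where d: "d > 0"
    "\<And>j x y. j \<in> J \<Longrightarrow> x \<in> cball 0 (3/4) \<Longrightarrow> y \<in> cball 0 (3/4) \<Longrightarrow> dist y x < d \<Longrightarrow> \<bar>Re (L j y) - Re (L j x)\<bar> < K / 2"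
    by blast
  have pw: "(0::real) < (1/2)^m" "(1/2::real)^m \<le> 1" for m :: nat by (auto simp: power_le_one)
  obtain M :: nat where M: "(1/2)^M < 8 * d" using real_arch_pow_inv[of "8 * d" "1/2"] d(1) by auto
  \<comment> \<open>On so small a scale the real parts of \<open>L j\<close> and \<open>L i\<close>
    each change by less than \<open>K / 2\<close>, and at \<open>z\<close> that of
    \<open>L i\<close> is the larger one, so an excess \<open>K\<close> is impossible.\<close>
  have bound: "m \<le> M" if Pm: "P m z" for m z
  proof (rule ccontr)
    assume "\<not> m \<le> M"
    then have "(1/2::real)^m \<le> (1/2)^M" by (intro power_decreasing) auto
    then have "(1/2::real)^m < 8 * d" using M by linarith
    then have small: "(1/2)^m / 8 < d" by simp
    obtain i j w where ijw: "top_index J L z i" "j \<in> J" "dist z w \<le> (1/2)^m / 8" "K \<le> Re (L j w) - Re (L i w)"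
      and z: "norm z \<le> 1/2 - (1/2)^m / 2" using Pm by (auto simp: P_def)
    have "norm w \<le> norm z + dist z w" by (metis dist_0_norm dist_triangle)
    then have w: "w \<in> cball 0 (3/4)" "z \<in> cball 0 (3/4)" using z ijw(3) pw[of m] by (simp_all, linarith+)
    have wz: "dist w z < d" using ijw(3) small by (simp add: dist_commute)
    have "i \<in> J" "Re (L j z) \<le> Re (L i z)" using ijw by (auto simp: top_index_def)
    then show False using d(2)[OF ijw(2) w(2) w(1) wz] d(2)[OF \<open>i \<in> J\<close> w(2) w(1) wz] ijw(4) by linarith
  qed
  define A where "A = {m. \<exists>z. P m z}"
  have finA: "finite A" by (rule finite_subset[of _ "{..M}"]) (use bound in \<open>auto simp: A_def\<close>)
  have "0 \<in> A" using P0 by (auto simp: A_def)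
  define m where "m = Max A"
  have "m \<in> A" unfolding m_def using finA \<open>0 \<in> A\<close> by (intro Max_in) auto
  then obtain z where Pz: "P m z" by (auto simp: A_def)
  have no: "\<not> P (Suc m) z'" for z'
  proof
    assume "P (Suc m) z'"
    then have "Suc m \<le> m" unfolding m_def using finA by (intro Max_ge) (auto simp: A_def)
    then show False by simp
  qed
  define r :: real where "r = (1/2)^m / 8"
  obtain i j w where ijw: "top_index J L z i" "j \<in> J" "dist z w \<le> r" "K \<le> Re (L j w) - Re (L i w)"
    and z: "norm z \<le> 1/2 - 4 * r" using Pz by (auto simp: P_def r_def)
  show ?thesis
  proof (rule that[OF _ _ ijw])
    show r0: "0 < r" by (simp add: r_def)
    show "norm z + 3 * r < 1" using z r0 by linarith
    fix z' i j w assume *: "dist z z' \<le> 2 * r" "top_index J L z' i" "j \<in> J" "dist z' w \<le> r / 2"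
    have "norm z' \<le> norm z + dist z z'" by (metis dist_0_norm dist_triangle)
    then have "norm z' \<le> 1/2 - 2 * r" using z * by linarith
    moreover have "2 * r = (1/2)^(Suc m) / 2" "r / 2 = (1/2)^(Suc m) / 8" by (simp_all add: r_def)
    ultimately show "Re (L j w) - Re (L i w) < K"
      using no[of z'] * unfolding P_def by (metis linorder_not_le)
  qed
qed

text \<open>Walk from \<open>0\<close> to \<open>z\<close> along a radius. Near each stop the top
  function there stays within 1 of the maximum, which is nonnegative; adding 2 makes it positive,
  and Harnack applies. All other functions exceed it by less than 1.\<close>

lemma Harnack_chain:
  assumes J: "finite J" "J \<noteq> {}" and hol: "\<And>j. j \<in> J \<Longrightarrow> L j holomorphic_on ball 0 2"
    and nonneg: "\<And>z. z \<in> ball 0 2 \<Longrightarrow> \<exists>j\<in>J. 0 \<le> Re (L j z)" and zero: "\<And>j. j \<in> J \<Longrightarrow> Re (L j 0) \<le> 0"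
    and close: "\<And>z i j w. z \<in> ball 0 2 \<Longrightarrow> top_index J L z i \<Longrightarrow> j \<in> J \<Longrightarrow> dist z w \<le> 1/2 \<Longrightarrow>
       Re (L j w) - Re (L i w) < 1"
    and z: "z \<in> ball 0 (3/2)" "j \<in> J"
  shows "Re (L j z) \<le> 3 ^ 7"
proof -
  \<comment> \<open>The bounds \<open>b m = 3 ^ (m + 1) - 3\<close> satisfy
    \<open>b (m + 1) = 3 * b m + 6\<close>, which covers one step: triple \<open>L i + 2\<close>,
    subtract 2, add 1. Six steps of length at most \<open>1/4\<close> reach radius
    \<open>3/2\<close>.\<close>
  have "Re (L j z) \<le> 3 ^ (m + 1) - 3" if "norm z < 3/2" "norm z \<le> real m / 4" "j \<in> J" for m z j
    using that
  proof (induction m arbitrary: z j)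
    case 0
    then show ?case using zero by simp
  next
    case (Suc m)
    define z' where "z' = of_real (real m / real (m + 1)) * z"
    have nz': "norm z' = real m / real (m + 1) * norm z" unfolding z'_def norm_mult norm_of_real by simp
    also have "\<dots> \<le> real m / real (m + 1) * (real (Suc m) / 4)" using Suc.prems by (intro mult_left_mono) auto
    finally have z'm: "norm z' \<le> real m / 4" by simp
    have "real m / real (m + 1) * norm z \<le> 1 * norm z" by (intro mult_right_mono) auto
    then have z'b: "norm z' < 3/2" using nz' Suc.prems(1) by linarith
    have "z' - z = of_real (real m / real (m + 1) - 1) * z" by (simp add: z'_def left_diff_distrib)
    moreover have "real m / real (m + 1) - 1 = - 1 / real (m + 1)" by (simp add: field_simps)
    ultimately have "dist z' z = norm z / real (m + 1)" unfolding dist_norm by (simp only: norm_mult norm_of_real) simp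
    then have dz: "dist z' z \<le> 1/4" using Suc.prems(2) by (simp add: divide_le_eq)
    obtain i where i: "top_index J L z' i" using top_index_exists[OF J] by blast
    have iJ: "i \<in> J" using i by (simp add: top_index_def)
    define h where "h w = L i w + 2" for w
    have sub: "ball z' (1/2) \<subseteq> ball 0 2"
    proof
      fix w assume "w \<in> ball z' (1/2)"
      moreover have "norm w \<le> norm z' + dist z' w" by (metis dist_0_norm dist_triangle)
      ultimately show "w \<in> ball 0 2" using z'b by simp
    qed
    have z'2: "z' \<in> ball 0 2" using z'b by simp
    have hpos: "0 < Re (h w)" if "w \<in> ball z' (1/2)" for w
    proof -
      obtain l where l: "l \<in> J" "0 \<le> Re (L l w)" using nonneg[of w] sub \<open>w \<in> ball z' (1/2)\<close> by blast
      have "Re (L l w) - Re (L i w) < 1" using close[OF z'2 i l(1)] that by simp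
      then show ?thesis using l by (simp add: h_def)
    qed
    have holh: "h holomorphic_on ball z' (1/2)" unfolding h_def
      by (intro holomorphic_intros holomorphic_on_subset[OF hol[OF iJ] sub])
    have "Re (h z) \<le> 3 * Re (h z')"
      by (rule Harnack_half(2)[OF holh hpos]) (use dz in auto)
    moreover have "Re (L i z') \<le> 3 ^ (m + 1) - 3" using Suc.IH z'b z'm iJ by blast
    moreover have "Re (L j z) - Re (L i z) < 1" using close[OF z'2 i Suc.prems(3)] dz by simp
    ultimately show ?case by (simp add: h_def)
  qed
  from this[of z 6 j] z show ?thesis by simp
qed

text \<open>Stated for exponentials because the rescaled logarithms are bounded above only and may
  tend to minus infinity. The constant \<open>exp (3 ^ 7)\<close> comes from
  \<open>Harnack_chain\<close>; \<open>c\<close> is the slack in the domination, to be sent to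
  \<open>0\<close>.\<close>

definition rescaled_family :: "nat \<Rightarrow> 'a set \<Rightarrow> real \<Rightarrow> ('a \<Rightarrow> complex \<Rightarrow> complex) \<Rightarrow> bool" where
  "rescaled_family n J c F \<longleftrightarrow>
     (\<forall>j\<in>J. F j holomorphic_on ball 0 (3/2) \<and> cmod (F j 0) \<le> 1 \<and>
        (\<forall>z\<in>ball 0 (3/2). F j z \<noteq> 0 \<and> cmod (F j z) \<le> exp (3 ^ 7))) \<and>
     (\<forall>z\<in>ball 0 (3/2). \<exists>j\<in>J. 1 \<le> cmod (F j z)) \<and>
     (\<exists>j\<in>J. \<exists>z\<in>cball 0 1. exp 1 \<le> cmod (F j z)) \<and>
     (\<forall>z\<in>ball 0 (3/2). \<forall>I\<subseteq>J. card I = n + 1 \<longrightarrow> (\<forall>j\<in>J. \<exists>i\<in>I. cmod (F j z) \<le> exp c * cmod (F i z)))"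

text \<open>At the critical scale, recentre, stretch the radius \<open>r\<close> to 1, subtract the
  top function of the centre and divide by \<open>K\<close>. An excess \<open>K\<close> becomes 1
  and the domination constant \<open>C\<close> becomes \<open>C / K\<close>.\<close>

lemma rescaling:
  assumes J: "finite J" and dom: "dominated_family n J (ball 0 1) C L" and K: "0 < K"
    and start: "top_index J L 0 i" "j \<in> J" "norm w \<le> 1/8" "K \<le> Re (L j w) - Re (L i w)"
  shows "\<exists>F. rescaled_family n J (C / K) F"
proof -
  have hol: "\<And>j. j \<in> J \<Longrightarrow> L j holomorphic_on ball 0 1" using dom by (simp add: dominated_family_def)
  obtain z r i j w where r: "0 < r" "norm z + 3 * r < 1" and i: "top_index J L z i" and jw: "j \<in> J" "dist z w \<le> r"
    "K \<le> Re (L j w) - Re (L i w)" and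
    fine: "\<And>z' i j w. dist z z' \<le> 2 * r \<Longrightarrow> top_index J L z' i \<Longrightarrow> j \<in> J \<Longrightarrow> dist z' w \<le> r / 2 \<Longrightarrow>
       Re (L j w) - Re (L i w) < K"
    using critical_scale[OF J hol K start] by metis
  define p where "p \<zeta> = z + of_real r * \<zeta>" for \<zeta>
  have dp: "dist (p x) (p y) = r * dist x y" for x y
  proof -
    have "p x - p y = of_real r * (x - y)" by (simp add: p_def algebra_simps)
    then show ?thesis using r by (simp add: dist_norm norm_mult)
  qed
  have dpz: "dist z (p x) = r * norm x" for x using dp[of 0 x] by (simp add: p_def)
  have p1: "p x \<in> ball 0 1" if "norm x < 3" for x
  proof -
    have "norm (p x) \<le> norm z + dist z (p x)" by (metis dist_0_norm dist_triangle)
    moreover have "r * norm x < r * 3" using that r by (intro mult_strict_left_mono) auto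
    ultimately have "norm (p x) < 1" using r dpz[of x] by linarith
    then show ?thesis by simp
  qed
  have iJ: "i \<in> J" using i by (simp add: top_index_def)
  \<comment> \<open>Subtracting \<open>L i\<close> preserves differences and top indices and makes
    \<open>M i\<close> vanish identically, so that some modulus is always at least 1.\<close>
  define M where "M l \<zeta> = (L l (p \<zeta>) - L i (p \<zeta>)) / of_real K" for l \<zeta>
  have ReM: "Re (M l \<zeta>) = (Re (L l (p \<zeta>)) - Re (L i (p \<zeta>))) / K" for l \<zeta> by (simp add: M_def)
  have topM: "top_index J L (p x) l" if "top_index J M x l" for l x
    using that K by (auto simp: top_index_def ReM divide_le_cancel)
  have holL: "(\<lambda>\<zeta>. L l (p \<zeta>)) holomorphic_on ball 0 2" if "l \<in> J" for l
    by (rule holomorphic_on_compose_gen[OF _ hol[OF that], unfolded o_def])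
       (use p1 in \<open>auto simp: p_def[abs_def] intro!: holomorphic_intros\<close>)
  have holM: "M l holomorphic_on ball 0 2" if "l \<in> J" for l
    unfolding M_def[abs_def] using K by (intro holomorphic_intros holL that iJ) auto
  have Mi: "M i x = 0" for x by (simp add: M_def)
  have zero: "Re (M l 0) \<le> 0" if "l \<in> J" for l
    using i that K by (simp add: ReM top_index_def p_def divide_nonpos_pos)
  have closeM: "Re (M b y) - Re (M a y) < 1"
    if "x \<in> ball 0 2" "top_index J M x a" "b \<in> J" "dist x y \<le> 1/2" for x y a b
  proof -
    have "Re (L b (p y)) - Re (L a (p y)) < K"
      by (rule fine[OF _ topM[OF that(2)] that(3)]) (use that dp dpz r in \<open>auto simp: mult_left_mono\<close>)
    then show ?thesis using K by (simp add: ReM diff_divide_distrib[symmetric])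
  qed
  have bound: "Re (M l x) \<le> 3 ^ 7" if "x \<in> ball 0 (3/2)" "l \<in> J" for x l
  proof (rule Harnack_chain[OF J _ holM _ zero closeM that])
    show "\<exists>j\<in>J. 0 \<le> Re (M j z)" for z using iJ Mi by (intro bexI[of _ i]) auto
  qed (use iJ in auto)
  obtain y where y: "w = p y"
  proof
    show "w = p ((w - z) / of_real r)" using r by (simp add: p_def)
  qed
  have "norm y \<le> 1" using jw(2) dpz[of y] y r by simp
  moreover have "1 \<le> Re (M j y)" using jw(3) K y by (simp add: ReM)
  ultimately have big: "\<exists>j\<in>J. \<exists>z\<in>cball 0 1. 1 \<le> Re (M j z)"
    using jw(1) by (intro bexI[of _ j] bexI[of _ y]) auto
  have domM: "\<exists>a\<in>I. Re (M b x) \<le> C / K + Re (M a x)"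
    if "x \<in> ball 0 (3/2)" "I \<subseteq> J" "card I = n + 1" "b \<in> J" for x I b
  proof -
    have "p x \<in> ball 0 1" using that p1 by simp
    then obtain a where a: "a \<in> I" "Re (L b (p x)) \<le> Re (L a (p x)) + C"
      using dom \<open>I \<subseteq> J\<close> \<open>card I = n + 1\<close> \<open>b \<in> J\<close> unfolding dominated_family_def by blast
    then have "Re (M b x) \<le> C / K + Re (M a x)" using K
      by (simp add: ReM add_divide_distrib[symmetric] divide_le_cancel)
    with a show ?thesis by blast
  qed
  have nonneg: "\<exists>j\<in>J. 0 \<le> Re (M j z)" for z using iJ Mi by (intro bexI[of _ i]) auto
  have holM': "(\<lambda>x. exp (M l x)) holomorphic_on ball 0 (3/2)" if "l \<in> J" for l
    by (intro holomorphic_intros holomorphic_on_subset[OF holM[OF that]]) auto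
  show ?thesis
    unfolding rescaled_family_def
  proof (intro exI[of _ "\<lambda>l x. exp (M l x)"] conjI ballI allI impI)
    show "\<exists>j\<in>J. \<exists>z\<in>cball 0 1. exp 1 \<le> cmod (exp (M j z))" using big by simp
    show "\<exists>i\<in>I. cmod (exp (M j z)) \<le> exp (C / K) * cmod (exp (M i z))"
      if "z \<in> ball 0 (3/2)" "I \<subseteq> J" "card I = n + 1" "j \<in> J" for z I j
      using domM[OF that] by (simp flip: exp_add)
  qed (use holM' bound zero nonneg in auto)
qed

text \<open>In the limit the domination is exact and, by Hurwitz, each function is zero or
  zero-free, so one limit dominates all others. Its modulus is at least 1 everywhere and at most 1
  at \<open>0\<close>, hence it is constant and all limits are bounded by 1, against the excess on
  the closed unit disc.\<close>

lemma no_rescaled_limit: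
  assumes J: "finite J" "card J = 2 * n + 1" and F: "\<And>k. rescaled_family n J (C / real (Suc k)) (F k)"
  shows False
proof -
  define S :: "complex set" where "S = ball 0 (3/2)"
  have S: "open S" "connected S" "S \<noteq> {}" "cball 0 1 \<subseteq> S" "0 \<in> S" by (auto simp: S_def)
  note F' = F[unfolded rescaled_family_def, folded S_def]
  obtain G r where r: "strict_mono (r :: nat \<Rightarrow> nat)" and holG: "\<And>j. j \<in> J \<Longrightarrow> G j holomorphic_on S" and
    lim: "\<And>j K. j \<in> J \<Longrightarrow> compact K \<Longrightarrow> K \<subseteq> S \<Longrightarrow> uniform_limit K (\<lambda>k. F (r k) j) (G j) sequentially"
    using Montel_finite_family[OF J(1) S(1), of F "exp (3 ^ 7)"] F' by metis
  have ptw: "(\<lambda>k. F (r k) j z) \<longlonglongrightarrow> G j z" if "j \<in> J" "z \<in> S" for j z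
    by (rule tendsto_uniform_limitI[OF lim[OF that(1), of "{z}"]]) (use that in auto)
  have nz: "(\<forall>z\<in>S. G j z = 0) \<or> (\<forall>z\<in>S. G j z \<noteq> 0)" if j: "j \<in> J" for j
  proof (cases "G j constant_on S")
    case True
    then show ?thesis by (auto simp: constant_on_def)
  next
    case False
    have "G j z \<noteq> 0" if "z \<in> S" for z
      by (rule Hurwitz_no_zeros[OF S(1,2) _ holG[OF j] lim[OF j] False _ that]) (use F' j in auto)
    then show ?thesis by blast
  qed
  have domG: "\<exists>i\<in>I. cmod (G j z) \<le> cmod (G i z)" if z: "z \<in> S" and I: "I \<subseteq> J" "card I = n + 1" and j: "j \<in> J" for z I j
  proof (rule ccontr)
    assume neg: "\<not> ?thesis"
    have finI: "finite I" using I J finite_subset by blast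
    \<comment> \<open>The index supplied by \<open>rescaled_family\<close> may change with
      \<open>k\<close>, so all \<open>i\<close> in the finite set \<open>I\<close> are refuted at
      one common \<open>k\<close>.\<close>
    have ev: "\<forall>\<^sub>F k in sequentially. 0 < cmod (F (r k) j z) - exp (C / real (Suc (r k))) * cmod (F (r k) i z)" if i: "i \<in> I" for i
    proof -
      have "(\<lambda>k. C / real (Suc (r k))) \<longlonglongrightarrow> 0"
        using LIMSEQ_subseq_LIMSEQ[OF LIMSEQ_Suc[OF lim_const_over_n[of C]] r] by (simp add: o_def)
      then have "(\<lambda>k. cmod (F (r k) j z) - exp (C / real (Suc (r k))) * cmod (F (r k) i z))
          \<longlonglongrightarrow> cmod (G j z) - exp 0 * cmod (G i z)"
        using i I(1) j z by (intro tendsto_intros ptw) auto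
      moreover have "0 < cmod (G j z) - exp 0 * cmod (G i z)" using neg i by (auto simp: not_le)
      ultimately show ?thesis by (rule order_tendstoD)
    qed
    have "\<forall>\<^sub>F k in sequentially. \<forall>i\<in>I. 0 < cmod (F (r k) j z) - exp (C / real (Suc (r k))) * cmod (F (r k) i z)"
      using ev finI by (simp add: eventually_ball_finite)
    then obtain k where k: "\<forall>i\<in>I. 0 < cmod (F (r k) j z) - exp (C / real (Suc (r k))) * cmod (F (r k) i z)"
      by (auto simp: eventually_sequentially)
    obtain i where "i \<in> I" "cmod (F (r k) j z) \<le> exp (C / real (Suc (r k))) * cmod (F (r k) i z)"
      using F' z I j by blast
    with k show False by force
  qed
  obtain k where k: "k \<in> J" and kmax: "\<And>z j. z \<in> S \<Longrightarrow> j \<in> J \<Longrightarrow> cmod (G j z) \<le> cmod (G k z)"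
    using dominant_function[of S J n G, OF S(1-3) J holG nz domG] by blast
  have ge1: "1 \<le> cmod (G k z)" if z: "z \<in> S" for z
  proof (rule ccontr)
    assume "\<not> ?thesis"
    then have "\<And>j. j \<in> J \<Longrightarrow> cmod (G j z) < 1" using kmax[OF z] by (meson not_le order_le_less_trans)
    then have "\<forall>\<^sub>F m in sequentially. \<forall>j\<in>J. cmod (F (r m) j z) < 1"
      using J by (intro eventually_ball_finite ballI order_tendstoD(2)[OF tendsto_norm[OF ptw[OF _ z]]]) auto
    then obtain m where "\<forall>j\<in>J. cmod (F (r m) j z) < 1" by (auto simp: eventually_sequentially)
    moreover have "\<exists>j\<in>J. 1 \<le> cmod (F (r m) j z)" using F' z by blast
    ultimately show False by force
  qed
  have le1: "cmod (G k 0) \<le> 1"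
    by (rule LIMSEQ_le_const2[OF tendsto_norm[OF ptw[OF k S(5)]]]) (use F' k in auto)
  have knz: "G k z \<noteq> 0" if "z \<in> S" for z using ge1[OF that] by auto
  \<comment> \<open>Minimum principle: the modulus of \<open>G k\<close> is smallest at the interior
    point \<open>0\<close>.\<close>
  have "(\<lambda>z. inverse (G k z)) constant_on S"
  proof (rule maximum_modulus_principle[OF _ S(1,2,1) order_refl S(5)])
    show "(\<lambda>z. inverse (G k z)) holomorphic_on S" using knz by (intro holomorphic_intros holG k)
    fix z assume z: "z \<in> S"
    have "cmod (G k 0) \<le> cmod (G k z)" using ge1[OF z] le1 by linarith
    then show "cmod (inverse (G k z)) \<le> cmod (inverse (G k 0))"
      using knz[OF S(5)] by (simp add: norm_inverse le_imp_inverse_le)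
  qed
  then have const: "G k z = G k 0" if "z \<in> S" for z
    using that S(5) unfolding constant_on_def by (metis inverse_inverse_eq)
  have small: "cmod (G j z) \<le> 1" if "z \<in> S" "j \<in> J" for z j
    using kmax[OF that] const[OF that(1)] le1 by simp
  have "\<forall>\<^sub>F m in sequentially. \<forall>j\<in>J. \<forall>z\<in>cball 0 1. dist (F (r m) j z) (G j z) < 1"
    using J S(4) by (intro eventually_ball_finite ballI uniform_limitD lim) auto
  then obtain m where m: "\<And>j z. j \<in> J \<Longrightarrow> z \<in> cball 0 1 \<Longrightarrow> dist (F (r m) j z) (G j z) < 1"
    unfolding eventually_sequentially by blast
  \<comment> \<open>The point \<open>z\<close> depends on \<open>m\<close>, so uniform convergence
    is used: a limit of modulus at most 1 and an error below 1 would give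
    \<open>exp 1 < 2\<close>.\<close>
  obtain j z where jz: "j \<in> J" "z \<in> cball 0 1" "exp 1 \<le> cmod (F (r m) j z)" using F' by blast
  have "cmod (F (r m) j z) \<le> cmod (G j z) + dist (F (r m) j z) (G j z)"
    by (metis dist_norm norm_triangle_sub)
  then have "exp 1 < (2::real)" using jz m[OF jz(1,2)] small[of z j] S(4) by fastforce
  moreover have "1 + 1 \<le> exp (1::real)" by (rule exp_ge_add_one_self)
  ultimately show False by simp
qed

text \<open>Compactness: families violating the bound for every \<open>K = 1, 2, ...\<close> would
  give rescaled families with slack \<open>C / K\<close> tending to \<open>0\<close>. The constant
  is uniform in \<open>L\<close>.\<close>

lemma uniform_defect:
  assumes J: "finite J" "card J = 2 * n + 1"
  shows "\<exists>K>0. \<forall>L. dominated_family n J (ball 0 1) C L \<longrightarrow>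
    (\<forall>i j w. top_index J L 0 i \<longrightarrow> j \<in> J \<longrightarrow> norm w \<le> 1/8 \<longrightarrow> Re (L j w) \<le> Re (L i w) + K)"
proof (rule ccontr)
  assume neg: "\<not> ?thesis"
  have "\<exists>F. rescaled_family n J (C / real (Suc k)) F" for k
  proof -
    have "real (Suc k) > 0" by simp
    then obtain L i j w where "dominated_family n J (ball 0 1) C L" "top_index J L 0 i" "j \<in> J" "norm w \<le> 1/8"
      "\<not> Re (L j w) \<le> Re (L i w) + real (Suc k)" using neg by blast
    then show ?thesis by (intro rescaling[OF J(1)]) auto
  qed
  then obtain F where "\<And>k. rescaled_family n J (C / real (Suc k)) (F k)" by metis
  then show False by (rule no_rescaled_limit[OF J])
qed

text \<open>The summand \<open>1\<close> makes logarithms of and division by the height harmless.\<close>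

definition height :: "'a set \<Rightarrow> ('a \<Rightarrow> real) \<Rightarrow> real" where
  "height J x = 1 + Max ((\<lambda>j. \<bar>x j\<bar>) ` J)"

lemma abs_le_height: "finite J \<Longrightarrow> j \<in> J \<Longrightarrow> \<bar>x j\<bar> + 1 \<le> height J x"
  unfolding height_def by (simp add: add.commute)

lemma height_le:
  assumes "finite J" "J \<noteq> {}" and "\<And>j. j \<in> J \<Longrightarrow> \<bar>x j\<bar> + 1 \<le> B"
  shows "height J x \<le> B"
proof -
  have "Max ((\<lambda>j. \<bar>x j\<bar>) ` J) \<le> B - 1"
    using assms(1,2) by (intro Max.boundedI) (auto simp: le_diff_eq intro: assms(3))
  then show ?thesis by (simp add: height_def)
qed

lemma height_ge_1: "finite J \<Longrightarrow> J \<noteq> {} \<Longrightarrow> 1 \<le> height J x"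
  using abs_le_height[of J _ x] by force

text \<open>The member that vanishes identically keeps the maximum nonnegative, so the defect bounds
  the top function at \<open>0\<close> from below on a disc. Harnack then bounds it, hence all
  functions, from above on a smaller disc, and Harnack applied below that common bound gives the
  estimate.\<close>

lemma log_family_Lipschitz:
  assumes J: "finite J" "card J = 2 * n + 1" and b: "b \<in> J"
  shows "\<exists>B\<ge>1. \<forall>L. dominated_family n J (ball 0 1) C L \<longrightarrow> (\<forall>z. L b z = 0) \<longrightarrow>
    (\<forall>j\<in>J. \<forall>w. norm w \<le> 1/32 \<longrightarrow> cmod (L j w - L j 0) \<le> B * height J (\<lambda>j. Re (L j 0)) * norm w)"
proof -
  obtain K where K: "K > 0" and defect: "\<And>L i j w. dominated_family n J (ball 0 1) C L \<Longrightarrow> top_index J L 0 i \<Longrightarrow>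
     j \<in> J \<Longrightarrow> norm w \<le> 1/8 \<Longrightarrow> Re (L j w) \<le> Re (L i w) + K"
    using uniform_defect[OF J] by metis
  \<comment> \<open>\<open>64 = 4 * 16\<close> comes from Harnack on the disc of radius
    \<open>1/16\<close>, and \<open>5 + 3 * K\<close> bounds \<open>Re (H 0) / U\<close> for the
    \<open>H\<close> below.\<close>
  define B where "B = 64 * (5 + 3 * K)"
  have "cmod (L j w - L j 0) \<le> B * height J (\<lambda>j. Re (L j 0)) * norm w"
    if L: "dominated_family n J (ball 0 1) C L" and zero: "\<And>z. L b z = 0" and j: "j \<in> J" and w: "norm w \<le> 1/32" for L j w
  proof -
    define U where "U = height J (\<lambda>j. Re (L j 0))"
    have hol: "\<And>j. j \<in> J \<Longrightarrow> L j holomorphic_on ball 0 1" using L by (simp add: dominated_family_def)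
    have leU: "\<bar>Re (L l 0)\<bar> + 1 \<le> U" if "l \<in> J" for l
      unfolding U_def using abs_le_height[OF J(1) that, of "\<lambda>j. Re (L j 0)"] .
    obtain i where i: "top_index J L 0 i" using top_index_exists[of J L 0] J b by blast
    have iJ: "i \<in> J" using i by (simp add: top_index_def)
    define h where "h z = L i z + of_real (K + 1)" for z
    have hpos: "0 < Re (h z)" if "z \<in> ball 0 (1/8)" for z
      using defect[OF L i b, of z] that zero by (simp add: h_def)
    have holh: "h holomorphic_on ball 0 (1/8)" unfolding h_def
      by (intro holomorphic_intros holomorphic_on_subset[OF hol[OF iJ]]) auto
    have up: "Re (L l z) \<le> 3 * (U + K)" if "l \<in> J" "norm z \<le> 1/16" for l z
    proof -
      have "Re (L l z) \<le> Re (L i z) + K" using defect[OF L i that(1)] that by simp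
      moreover have "Re (h z) \<le> 3 * Re (h 0)"
        by (rule Harnack_half(2)[OF holh hpos]) (use that in auto)
      ultimately show ?thesis using leU[OF iJ] by (simp add: h_def)
    qed
    define H where "H z = of_real (3 * (U + K) + 1) - L j z" for z
    have "cmod (H w - H 0) * (1/16) \<le> 4 * dist 0 w * Re (H 0)"
    proof (rule Harnack_half(1))
      show "H holomorphic_on ball 0 (1/16)" unfolding H_def
        by (intro holomorphic_intros holomorphic_on_subset[OF hol[OF j]]) auto
      show "0 < Re (H z)" if "z \<in> ball 0 (1/16)" for z using up[OF j, of z] that by (simp add: H_def)
    qed (use w in auto)
    moreover have "cmod (H w - H 0) = cmod (L j w - L j 0)" by (simp add: H_def norm_minus_commute)
    ultimately have 1: "cmod (L j w - L j 0) \<le> 64 * norm w * Re (H 0)" by simp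
    have "Re (H 0) \<le> (5 + 3 * K) * U"
    proof -
      have "1 \<le> U" using leU[OF j] by simp
      then have "K * 1 \<le> K * U" using K by (intro mult_left_mono) auto
      then show ?thesis using leU[OF j] by (simp add: H_def algebra_simps)
    qed
    then have "64 * norm w * Re (H 0) \<le> 64 * norm w * ((5 + 3 * K) * U)" by (intro mult_left_mono) auto
    with 1 show ?thesis by (simp add: B_def U_def algebra_simps)
  qed
  moreover have "1 \<le> B" using K by (simp add: B_def)
  ultimately show ?thesis by blast
qed

subsection \<open>Monic polynomials and interpolation\<close>

lemma poly_linear_prod: "poly (\<Prod>i\<in>A. [:- f i, 1:]) t = (\<Prod>i\<in>A. t - f i)" for t :: "'a::comm_ring_1"
  by (simp add: poly_prod)

lemma degree_linear_prod: "degree (\<Prod>i\<in>A. [:- f i, 1:]) = card A" for f :: "'b \<Rightarrow> 'a::idom"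
  by (subst degree_prod_sum_eq) auto

lemma coeff_linear_prod: "coeff (\<Prod>i\<in>A. [:- f i, 1:]) (card A) = 1" for f :: "'b \<Rightarrow> 'a::idom"
  using lead_coeff_prod[of "\<lambda>i. [:- f i, 1:]" A] by (simp add: degree_linear_prod)

definition Lagrange_basis :: "'a::field set \<Rightarrow> 'a \<Rightarrow> 'a poly" where
  "Lagrange_basis A a = smult (1 / (\<Prod>b\<in>A - {a}. a - b)) (\<Prod>b\<in>A - {a}. [:- b, 1:])"

lemma degree_Lagrange_basis: "finite A \<Longrightarrow> a \<in> A \<Longrightarrow> degree (Lagrange_basis A a) < card A"
  using degree_linear_prod[of "\<lambda>b. b" "A - {a}"] card_gt_0_iff[of A]
  by (auto simp: Lagrange_basis_def)

lemma poly_Lagrange_basis: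
  assumes "finite A" "a \<in> A" "b \<in> A"
  shows "poly (Lagrange_basis A a) b = (if a = b then 1 else 0)"
  using assms poly_linear_prod[of "\<lambda>b. b" "A - {a}"] by (auto simp: Lagrange_basis_def)

lemma poly_Lagrange_sum:
  assumes "finite A" "b \<in> A"
  shows "poly (\<Sum>a\<in>A. smult (c a) (Lagrange_basis A a)) b = c b"
proof -
  have "poly (\<Sum>a\<in>A. smult (c a) (Lagrange_basis A a)) b = (\<Sum>a\<in>A. if a = b then c a else 0)"
    unfolding poly_sum using assms by (intro sum.cong) (auto simp: poly_Lagrange_basis)
  then show ?thesis using assms by simp
qed

lemma degree_Lagrange_sum:
  assumes "finite A" "A \<noteq> {}"
  shows "degree (\<Sum>a\<in>A. smult (c a) (Lagrange_basis A a)) < card A"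
proof (rule degree_sum_less)
  show "degree (smult (c a) (Lagrange_basis A a)) < card A" if "a \<in> A" for a
    using degree_smult_le degree_Lagrange_basis[OF assms(1) that] by (rule le_less_trans)
qed (use assms in \<open>simp add: card_gt_0_iff\<close>)

lemma Lagrange_interpolation:
  assumes "finite A" "degree p < card A"
  shows "p = (\<Sum>a\<in>A. smult (poly p a) (Lagrange_basis A a))"
proof (rule poly_eqI_degree[of A])
  show "degree (\<Sum>a\<in>A. smult (poly p a) (Lagrange_basis A a)) < card A"
    using assms by (intro degree_Lagrange_sum) auto
qed (use assms poly_Lagrange_sum[OF assms(1), of _ "poly p"] in auto)

text \<open>With the leading coefficient known, \<open>card A\<close> nodes suffice in degree
  \<open>card A\<close>: infinity acts as an additional node.\<close>

lemma Lagrange_interpolation_monic: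
  assumes A: "finite A" and p: "degree p \<le> card A" "coeff p (card A) = 1"
  shows "p = (\<Prod>a\<in>A. [:- a, 1:]) + (\<Sum>a\<in>A. smult (poly p a) (Lagrange_basis A a))"
proof (cases "A = {}")
  case True
  then show ?thesis using p by (auto simp: one_pCons elim!: degree_eq_zeroE)
next
  case False
  let ?q = "\<Prod>a\<in>A. [:- a, 1:]" and ?s = "\<Sum>a\<in>A. smult (poly p a) (Lagrange_basis A a)"
  have s: "degree ?s < card A" using A False by (intro degree_Lagrange_sum)
  show ?thesis
  proof (rule poly_eqI_degree_lead_coeff[of _ "card A" _ A])
    show "coeff p (card A) = coeff (?q + ?s) (card A)"
      using p coeff_linear_prod[of "\<lambda>a. a" A] coeff_eq_0[OF s] by simp
    show "degree (?q + ?s) \<le> card A"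
      using s degree_linear_prod[of "\<lambda>a. a" A] by (intro degree_add_le) auto
    fix z assume "z \<in> A"
    moreover from this have "poly ?q z = 0" using A by (simp add: poly_linear_prod[of "\<lambda>a. a"])
    ultimately show "poly p z = poly (?q + ?s) z" using A by (simp add: poly_Lagrange_sum)
  qed (use p in auto)
qed

section \<open>The monic polynomial of a point\<close>

text \<open>The signs make \<open>symmetrization n l\<close> correspond to the polynomial with zeros
  \<open>l i\<close>. Only coordinates in \<open>{1..n}\<close> are read, so coordinatewise limits
  need not be extensional.\<close>

definition vieta_poly :: "nat \<Rightarrow> cvec \<Rightarrow> complex poly" where
  "vieta_poly n z = monom 1 n + (\<Sum>j = 1..n. monom ((-1) ^ j * z j) (n - j))"

lemma poly_vieta_poly: "poly (vieta_poly n z) t = t ^ n + (\<Sum>j = 1..n. (-1) ^ j * z j * t ^ (n - j))"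
  by (simp add: vieta_poly_def poly_monom poly_sum)

lemma degree_vieta_poly_le: "degree (vieta_poly n z) \<le> n"
  unfolding vieta_poly_def
  by (intro degree_add_le degree_sum_le) (auto intro: order_trans[OF degree_monom_le])

lemma coeff_vieta_poly_top: "coeff (vieta_poly n z) n = 1"
proof -
  have "(\<Sum>j = 1..n. if n - j = n then (-1) ^ j * z j else 0) = 0" by (intro sum.neutral) auto
  then show ?thesis by (simp add: vieta_poly_def coeff_sum)
qed

lemma coeff_vieta_poly:
  assumes "j \<in> {1..n}"
  shows "coeff (vieta_poly n z) (n - j) = (-1) ^ j * z j"
proof -
  have "(\<Sum>i = 1..n. if n - i = n - j then (-1) ^ i * z i else 0) = (\<Sum>i = 1..n. if i = j then (-1) ^ i * z i else 0)"
    using assms by (intro sum.cong) auto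
  then show ?thesis using assms by (auto simp: vieta_poly_def coeff_sum)
qed

lemma vieta_poly_inverse:
  assumes "j \<in> {1..n}"
  shows "(-1) ^ j * coeff (vieta_poly n z) (n - j) = z j"
  unfolding coeff_vieta_poly[OF assms] by (simp flip: mult.assoc power_mult_distrib)

lemma vieta_poly_coeffs:
  assumes "degree p \<le> n" "coeff p n = 1"
  shows "vieta_poly n (\<lambda>j\<in>{1..n}. (-1) ^ j * coeff p (n - j)) = p" (is "vieta_poly n ?z = p")
proof (rule poly_eqI)
  fix k
  consider "k = n" | "n < k" | "k < n" by linarith
  then show "coeff (vieta_poly n ?z) k = coeff p k"
  proof cases
    case 2
    then show ?thesis using assms(1) degree_vieta_poly_le[of n ?z] by (simp add: coeff_eq_0)
  next
    case 3
    then have "n - k \<in> {1..n}" "n - (n - k) = k" by auto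
    then show ?thesis using coeff_vieta_poly[of "n - k" n ?z] by (simp flip: mult.assoc power_mult_distrib)
  qed (simp add: assms coeff_vieta_poly_top)
qed

lemma vieta_poly_inj:
  assumes "w \<in> extensional {1..n}" "z \<in> extensional {1..n}" "vieta_poly n w = vieta_poly n z"
  shows "w = z"
  using assms vieta_poly_inverse by (metis extensionalityI)

text \<open>Expand the product over the subsets of factors that contribute a root, and group these
  subsets by size.\<close>

lemma vieta_poly_symmetrization: "vieta_poly n (symmetrization n l) = (\<Prod>i\<in>{1..n}. [:- l i, 1:])"
proof (rule iffD1[OF poly_eq_poly_eq_iff], rule ext)
  fix t
  have split: "(\<Sum>X\<in>Pow {1..n}. g X) = (\<Sum>j\<in>{0..n}. \<Sum>X | X \<subseteq> {1..n} \<and> card X = j. g X)" for g :: "nat set \<Rightarrow> complex"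
  proof -
    have "card ` Pow {1..n} \<subseteq> {0..n}" using card_mono[of "{1..n}"] by fastforce
    then have "(\<Sum>j\<in>{0..n}. \<Sum>X\<in>{X \<in> Pow {1..n}. card X = j}. g X) = (\<Sum>X\<in>Pow {1..n}. g X)"
      by (intro sum.group) auto
    then show ?thesis by simp
  qed
  have "(\<Prod>i\<in>{1..n}. t - l i) = (\<Prod>i\<in>{1..n}. - l i + t)" by simp
  also have "\<dots> = (\<Sum>X\<in>Pow {1..n}. (\<Prod>i\<in>X. - l i) * (\<Prod>i\<in>{1..n} - X. t))" by (rule prod_add) simp
  also have "\<dots> = (\<Sum>j\<in>{0..n}. \<Sum>X | X \<subseteq> {1..n} \<and> card X = j. (\<Prod>i\<in>X. - l i) * (\<Prod>i\<in>{1..n} - X. t))"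
    by (rule split)
  also have "\<dots> = (\<Sum>j\<in>{0..n}. (-1) ^ j * elem_sym n j l * t ^ (n - j))"
  proof (rule sum.cong[OF refl])
    fix j
    have "(\<Prod>i\<in>X. - l i) * (\<Prod>i\<in>{1..n} - X. t) = (-1) ^ j * (\<Prod>i\<in>X. l i) * t ^ (n - j)"
      if "X \<subseteq> {1..n}" "card X = j" for X
      using that by (simp add: prod_uminus card_Diff_subset finite_subset)
    then show "(\<Sum>X | X \<subseteq> {1..n} \<and> card X = j. (\<Prod>i\<in>X. - l i) * (\<Prod>i\<in>{1..n} - X. t)) = (-1) ^ j * elem_sym n j l * t ^ (n - j)"
      unfolding elem_sym_def sum_distrib_left sum_distrib_right by (intro sum.cong) auto
  qed
  also have "\<dots> = t ^ n + (\<Sum>j = 1..n. (-1) ^ j * elem_sym n j l * t ^ (n - j))"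
  proof -
    have "{X. X \<subseteq> {1..n} \<and> card X = 0} = {{}}" using finite_subset by fastforce
    then have "elem_sym n 0 l = 1" by (simp add: elem_sym_def)
    then show ?thesis by (simp add: sum.atLeast_Suc_atMost)
  qed
  also have "\<dots> = poly (vieta_poly n (symmetrization n l)) t"
    unfolding poly_vieta_poly by (simp add: symmetrization_def)
  finally show "poly (vieta_poly n (symmetrization n l)) t = poly (\<Prod>i\<in>{1..n}. [:- l i, 1:]) t"
    by (simp add: poly_linear_prod)
qed

lemma sym_product_extensional: "z \<in> sym_product n D \<Longrightarrow> z \<in> extensional {1..n}"
  by (auto simp: sym_product_def symmetrization_def)

text \<open>The polynomial splits over the complex numbers, so its zeros can be listed as a
  preimage. The criterion replaces the roots by the values at missing points, which are affine in
  \<open>z\<close> and hence holomorphic along discs.\<close>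

lemma mem_sym_product_iff:
  assumes z: "z \<in> extensional {1..n}"
  shows "z \<in> sym_product n D \<longleftrightarrow> (\<forall>a\<in>- D. poly (vieta_poly n z) a \<noteq> 0)"
proof
  assume "z \<in> sym_product n D"
  then obtain l where "l \<in> {1..n} \<rightarrow>\<^sub>E D" "z = symmetrization n l" by (auto simp: sym_product_def)
  then show "\<forall>a\<in>- D. poly (vieta_poly n z) a \<noteq> 0"
    by (auto simp: vieta_poly_symmetrization poly_linear_prod PiE_iff)
next
  assume nz: "\<forall>a\<in>- D. poly (vieta_poly n z) a \<noteq> 0"
  let ?p = "vieta_poly n z"
  have p0: "?p \<noteq> 0" using coeff_vieta_poly_top[of n z] by force
  have deg: "degree ?p = n"
    using degree_vieta_poly_le[of n z] coeff_vieta_poly_top[of n z] by (intro antisym le_degree) auto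
  obtain M where M: "size M = n" "?p = (\<Prod>x\<in>#M. [:- x, 1:])"
    using alg_closed_imp_factorization[OF p0] by (auto simp: deg coeff_vieta_poly_top)
  obtain xs where xs: "mset xs = M" by (metis ex_mset)
  \<comment> \<open>List positions start at 0, coordinates at 1.\<close>
  define l where "l = (\<lambda>i\<in>{1..n}. xs ! (i - 1))"
  have len: "length xs = n" using M xs by auto
  have "(\<Prod>x\<in>#M. [:- x, 1:]) = prod_list (map (\<lambda>x. [:- x, 1:]) xs)"
    unfolding xs[symmetric] by (simp flip: prod_mset_prod_list)
  also have "\<dots> = (\<Prod>i<n. [:- (xs ! i), 1:])"
    by (simp add: prod.list_conv_set_nth len atLeast0LessThan)
  also have "\<dots> = (\<Prod>i\<in>{1..n}. [:- l i, 1:])"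
    by (rule prod.reindex_bij_witness[of _ "\<lambda>i. i - 1" Suc]) (auto simp: l_def)
  finally have eq: "?p = (\<Prod>i\<in>{1..n}. [:- l i, 1:])" using M by simp
  then have "z = symmetrization n l"
    unfolding vieta_poly_symmetrization[symmetric]
    by (intro vieta_poly_inj[OF z]) (simp_all add: symmetrization_def)
  moreover have "l i \<in> D" if i: "i \<in> {1..n}" for i
  proof (rule ccontr)
    assume "l i \<notin> D"
    moreover have "poly ?p (l i) = 0" unfolding eq poly_linear_prod using i by auto
    ultimately show False using nz by auto
  qed
  ultimately show "z \<in> sym_product n D" by (auto simp: sym_product_def l_def)
qed

text \<open>\<open>None\<close> plays the role of the point at infinity, that is, of the leading coefficient.\<close>

definition value_at :: "nat \<Rightarrow> cvec \<Rightarrow> complex option \<Rightarrow> complex" where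
  "value_at n z x = (case x of None \<Rightarrow> 1 | Some a \<Rightarrow> poly (vieta_poly n z) a)"

lemma value_at_simps [simp]: "value_at n z None = 1" "value_at n z (Some a) = poly (vieta_poly n z) a"
  by (simp_all add: value_at_def)

text \<open>Interpolation at \<open>n + 1\<close> nodes, infinity included: its coefficients do not
  depend on the polynomial. The cases are monic and ordinary Lagrange interpolation.\<close>

lemma value_at_span:
  assumes I: "finite I" "card I = n + 1"
  shows "\<exists>c. \<forall>z. value_at n z x = (\<Sum>i\<in>I. c i * value_at n z i)"
proof (cases "None \<in> I")
  case True
  define B where "B = {b. Some b \<in> I}"
  have IB: "I = insert None (Some ` B)"
  proof (rule set_eqI)
    show "x \<in> I \<longleftrightarrow> x \<in> insert None (Some ` B)" for x using True by (cases x) (auto simp: B_def)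
  qed
  have finB: "finite B" using I(1) unfolding IB by (auto dest: finite_imageD)
  have cB: "card B = n" using I finB unfolding IB by (simp add: card_image)
  have eq: "vieta_poly n z = (\<Prod>a\<in>B. [:- a, 1:]) + (\<Sum>a\<in>B. smult (poly (vieta_poly n z) a) (Lagrange_basis B a))" for z
    using Lagrange_interpolation_monic[OF finB] degree_vieta_poly_le coeff_vieta_poly_top cB by auto
  have sumI: "(\<Sum>i\<in>I. g i) = g None + (\<Sum>b\<in>B. g (Some b))" for g :: "complex option \<Rightarrow> complex"
    unfolding IB using finB by (simp add: sum.reindex)
  show ?thesis
  proof (cases x)
    case None
    then show ?thesis by (intro exI[of _ "\<lambda>i. if i = None then 1 else 0"]) (simp add: sumI)
  next
    case (Some a)
    define c where "c i = (case i of None \<Rightarrow> poly (\<Prod>a\<in>B. [:- a, 1:]) a | Some b \<Rightarrow> poly (Lagrange_basis B b) a)" for i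
    have "value_at n z x = (\<Sum>i\<in>I. c i * value_at n z i)" for z
      using arg_cong[OF eq[of z], of "\<lambda>p. poly p a"] by (simp add: Some sumI c_def poly_sum mult.commute)
    then show ?thesis by blast
  qed
next
  case False
  define B where "B = {b. Some b \<in> I}"
  have IB: "I = Some ` B"
  proof (rule set_eqI)
    show "x \<in> I \<longleftrightarrow> x \<in> Some ` B" for x using False by (cases x) (auto simp: B_def)
  qed
  have finB: "finite B" using I(1) unfolding IB by (auto dest: finite_imageD)
  have cB: "card B = n + 1" using I finB unfolding IB by (simp add: card_image)
  have eq: "vieta_poly n z = (\<Sum>a\<in>B. smult (poly (vieta_poly n z) a) (Lagrange_basis B a))" for z
    using Lagrange_interpolation[OF finB, of "vieta_poly n z"] degree_vieta_poly_le[of n z] cB by auto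
  have sumI: "(\<Sum>i\<in>I. g i) = (\<Sum>b\<in>B. g (Some b))" for g :: "complex option \<Rightarrow> complex"
    unfolding IB by (simp add: sum.reindex)
  \<comment> \<open>The value at infinity is the coefficient in degree \<open>n\<close>, so for this
    target it is read off from the Lagrange basis.\<close>
  define c where "c i = (case x of None \<Rightarrow> coeff (Lagrange_basis B (the i)) n | Some a \<Rightarrow> poly (Lagrange_basis B (the i)) a)" for i
  have "value_at n z x = (\<Sum>i\<in>I. c i * value_at n z i)" for z
  proof (cases x)
    case None
    have "1 = coeff (\<Sum>a\<in>B. smult (poly (vieta_poly n z) a) (Lagrange_basis B a)) n"
      using eq[of z] coeff_vieta_poly_top[of n z] by simp
    then show ?thesis by (simp add: None sumI c_def coeff_sum mult.commute)
  next
    case (Some a)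
    then show ?thesis
      using arg_cong[OF eq[of z], of "\<lambda>p. poly p a"] by (simp add: sumI c_def poly_sum mult.commute)
  qed
  then show ?thesis by blast
qed

lemma value_at_dominated:
  assumes J: "finite J"
  shows "\<exists>C>0. \<forall>z I j. I \<subseteq> J \<longrightarrow> card I = n + 1 \<longrightarrow> j \<in> J \<longrightarrow>
    (\<exists>i\<in>I. cmod (value_at n z j) \<le> C * cmod (value_at n z i))"
proof -
  have "\<exists>c. \<forall>z. value_at n z j = (\<Sum>i\<in>I. c i * value_at n z i)" if "I \<subseteq> J" "card I = n + 1" for I j
    using value_at_span finite_subset[OF that(1) J] that by blast
  then obtain c where c: "\<And>I j z. I \<subseteq> J \<Longrightarrow> card I = n + 1 \<Longrightarrow> value_at n z j = (\<Sum>i\<in>I. c I j i * value_at n z i)"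
    by metis
  \<comment> \<open>A crude sum over the finitely many choices serves them all; the summand 1 makes
    it positive, as needed for \<open>ln C\<close> later.\<close>
  define C where "C = 1 + (\<Sum>I\<in>Pow J. \<Sum>j\<in>J. \<Sum>i\<in>I. cmod (c I j i))"
  have C0: "C > 0" unfolding C_def by (intro add_pos_nonneg sum_nonneg) auto
  have "\<exists>i\<in>I. cmod (value_at n z j) \<le> C * cmod (value_at n z i)" if I: "I \<subseteq> J" "card I = n + 1" and j: "j \<in> J" for z I j
  proof -
    have finI: "finite I" using I J finite_subset by blast
    have "I \<noteq> {}" using I by auto
    then have "Max ((\<lambda>i. cmod (value_at n z i)) ` I) \<in> (\<lambda>i. cmod (value_at n z i)) ` I"
      using finI by (intro Max_in) auto
    then obtain m where m: "m \<in> I" "Max ((\<lambda>i. cmod (value_at n z i)) ` I) = cmod (value_at n z m)" by blast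
    then have mmax: "cmod (value_at n z i) \<le> cmod (value_at n z m)" if "i \<in> I" for i
      using finI that by (metis Max_ge finite_imageI imageI)
    have "cmod (value_at n z j) \<le> (\<Sum>i\<in>I. cmod (c I j i * value_at n z i))"
      unfolding c[OF I, of z j] by (rule norm_sum)
    also have "\<dots> \<le> (\<Sum>i\<in>I. cmod (c I j i) * cmod (value_at n z m))"
      by (intro sum_mono) (simp add: norm_mult mmax mult_left_mono)
    also have "\<dots> = (\<Sum>i\<in>I. cmod (c I j i)) * cmod (value_at n z m)" by (simp add: sum_distrib_right)
    also have "\<dots> \<le> C * cmod (value_at n z m)"
    proof (rule mult_right_mono)
      have "(\<Sum>i\<in>I. cmod (c I j i)) \<le> (\<Sum>j\<in>J. \<Sum>i\<in>I. cmod (c I j i))"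
        using j J by (intro member_le_sum sum_nonneg) auto
      also have "\<dots> \<le> (\<Sum>I\<in>Pow J. \<Sum>j\<in>J. \<Sum>i\<in>I. cmod (c I j i))"
        using I J by (intro member_le_sum[of I "Pow J" "\<lambda>I. \<Sum>j\<in>J. \<Sum>i\<in>I. cmod (c I j i)"] sum_nonneg) auto
      finally show "(\<Sum>i\<in>I. cmod (c I j i)) \<le> C" by (simp add: C_def)
    qed simp
    finally show ?thesis using m(1) by blast
  qed
  with C0 show ?thesis by blast
qed

lemma coordinates_from_values:
  assumes A: "finite A" "card A = n"
  shows "\<exists>\<alpha> \<beta>. \<forall>z. \<forall>j\<in>{1..n}. z j = \<alpha> j + (\<Sum>a\<in>A. \<beta> j a * poly (vieta_poly n z) a)"
proof (intro exI allI ballI)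
  fix z :: cvec and j assume j: "j \<in> {1..n}"
  have eq: "vieta_poly n z = (\<Prod>a\<in>A. [:- a, 1:]) + (\<Sum>a\<in>A. smult (poly (vieta_poly n z) a) (Lagrange_basis A a))"
    using Lagrange_interpolation_monic[OF A(1)] degree_vieta_poly_le coeff_vieta_poly_top A(2) by auto
  have "z j = (-1) ^ j * coeff (vieta_poly n z) (n - j)" using vieta_poly_inverse[OF j] by simp
  also have "\<dots> = (-1) ^ j * coeff (\<Prod>a\<in>A. [:- a, 1:]) (n - j) +
      (\<Sum>a\<in>A. ((-1) ^ j * coeff (Lagrange_basis A a) (n - j)) * poly (vieta_poly n z) a)"
    by (subst eq) (simp add: coeff_sum distrib_left sum_distrib_left mult_ac)
  finally show "z j = (-1) ^ j * coeff (\<Prod>a\<in>A. [:- a, 1:]) (n - j) +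
      (\<Sum>a\<in>A. ((-1) ^ j * coeff (Lagrange_basis A a) (n - j)) * poly (vieta_poly n z) a)" .
qed

text \<open>The complement of \<open>D\<close> may be unbounded, so everything is measured against
  \<open>(1 + cmod t) ^ n\<close>: off \<open>D\<close> the polynomial of \<open>z\<close> is at
  least a fixed multiple of it, while perturbing the coefficients costs at most a small
  multiple.\<close>

lemma sym_product_nbhd:
  assumes D: "open D" and z: "z \<in> sym_product n D"
  shows "\<exists>\<eta>>0. \<forall>w\<in>extensional {1..n}. (\<forall>j\<in>{1..n}. cmod (w j - z j) \<le> \<eta>) \<longrightarrow> w \<in> sym_product n D"
proof -
  obtain l where l: "l \<in> {1..n} \<rightarrow>\<^sub>E D" "z = symmetrization n l" using z by (auto simp: sym_product_def)
  have "\<exists>r>0. \<forall>i\<in>{1..n}. ball (l i) r \<subseteq> D"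
  proof -
    have "\<forall>i\<in>{1..n}. \<exists>r>0. ball (l i) r \<subseteq> D" using l D by (auto simp: PiE_iff open_contains_ball)
    then obtain r where r: "\<And>i. i \<in> {1..n} \<Longrightarrow> r i > 0 \<and> ball (l i) (r i) \<subseteq> D" by metis
    have "0 < Min (insert 1 (r ` {1..n}))" using r by (subst Min_gr_iff) auto
    moreover have "ball (l i) (Min (insert 1 (r ` {1..n}))) \<subseteq> D" if "i \<in> {1..n}" for i
    proof -
      have "Min (insert 1 (r ` {1..n})) \<le> r i" using that by (intro Min_le) auto
      then show ?thesis using subset_ball r[OF that] by blast
    qed
    ultimately show ?thesis by blast
  qed
  then obtain r where r: "r > 0" "\<And>i. i \<in> {1..n} \<Longrightarrow> ball (l i) r \<subseteq> D" by blast
  \<comment> \<open>Off \<open>D\<close> we have \<open>r \<le> cmod (t - l i)\<close>, so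
    \<open>1 + cmod t\<close> is at most \<open>1 + (1 + cmod (l i)) / r\<close> times
    \<open>cmod (t - l i)\<close>; the sum makes this uniform in \<open>i\<close>.\<close>
  define E where "E = 1 + (1 + (\<Sum>i = 1..n. cmod (l i))) / r"
  have E1: "E \<ge> 1" using r by (simp add: E_def sum_nonneg)
  have root: "1 + cmod t \<le> E * cmod (t - l i)" if t: "t \<notin> D" and i: "i \<in> {1..n}" for t i
  proof -
    have "r \<le> cmod (t - l i)" using r(2)[OF i] t by (force simp: dist_norm norm_minus_commute not_less[symmetric])
    then have "(1 + cmod (l i)) / r * r \<le> (1 + cmod (l i)) / r * cmod (t - l i)"
      using r by (intro mult_left_mono) auto
    then have 1: "1 + cmod (l i) \<le> (1 + cmod (l i)) / r * cmod (t - l i)" using r by simp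
    have "cmod (l i) \<le> (\<Sum>i = 1..n. cmod (l i))" using i by (intro member_le_sum) auto
    then have "(1 + cmod (l i)) / r * cmod (t - l i) \<le> (1 + (\<Sum>i = 1..n. cmod (l i))) / r * cmod (t - l i)"
      using r by (intro mult_right_mono divide_right_mono) auto
    with 1 have "1 + cmod (l i) + cmod (t - l i) \<le> E * cmod (t - l i)"
      by (simp add: E_def distrib_right)
    moreover have "cmod t \<le> cmod (l i) + cmod (t - l i)" by (metis norm_triangle_sub)
    ultimately show ?thesis by linarith
  qed
  have lower: "(1 + cmod t) ^ n \<le> E ^ n * cmod (poly (vieta_poly n z) t)" if t: "t \<notin> D" for t
  proof -
    have "(1 + cmod t) ^ n = (\<Prod>i\<in>{1..n}. 1 + cmod t)" by simp
    also have "\<dots> \<le> (\<Prod>i\<in>{1..n}. E * cmod (t - l i))"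
      by (intro prod_mono conjI root[OF t]) auto
    also have "\<dots> = E ^ n * cmod (poly (vieta_poly n z) t)"
      by (simp add: l(2) vieta_poly_symmetrization poly_linear_prod prod.distrib prod_norm)
    finally show ?thesis .
  qed
  \<comment> \<open>Chosen so that the perturbation is at most \<open>n / (n + 1)\<close> times the
    value itself, which excludes a zero.\<close>
  define \<eta> where "\<eta> = 1 / ((real n + 1) * E ^ n)"
  have \<eta>0: "\<eta> > 0" using E1 by (simp add: \<eta>_def)
  have "w \<in> sym_product n D" if w: "w \<in> extensional {1..n}" and close: "\<forall>j\<in>{1..n}. cmod (w j - z j) \<le> \<eta>" for w
  proof (rule iffD2[OF mem_sym_product_iff[OF w]], intro ballI)
    fix t assume "t \<in> - D"
    then have t: "t \<notin> D" by simp
    have "poly (vieta_poly n w) t - poly (vieta_poly n z) t = (\<Sum>j = 1..n. (-1) ^ j * (w j - z j) * t ^ (n - j))"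
      by (simp add: poly_vieta_poly flip: sum_subtractf) (simp add: algebra_simps)
    also have "cmod \<dots> \<le> (\<Sum>j = 1..n. \<eta> * (1 + cmod t) ^ n)"
    proof (rule sum_norm_le)
      fix j assume j: "j \<in> {1..n}"
      have "cmod t ^ (n - j) \<le> (1 + cmod t) ^ (n - j)" by (intro power_mono) auto
      also have "\<dots> \<le> (1 + cmod t) ^ n" by (intro power_increasing) auto
      finally have "cmod (w j - z j) * cmod t ^ (n - j) \<le> \<eta> * (1 + cmod t) ^ n"
        using close j \<eta>0 by (intro mult_mono) auto
      then show "cmod ((-1) ^ j * (w j - z j) * t ^ (n - j)) \<le> \<eta> * (1 + cmod t) ^ n"
        by (simp add: norm_mult norm_power)
    qed
    also have "\<dots> = real n * \<eta> * (1 + cmod t) ^ n" by simp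
    also have "\<dots> \<le> real n * \<eta> * (E ^ n * cmod (poly (vieta_poly n z) t))"
      using lower[OF t] \<eta>0 by (intro mult_left_mono) auto
    also have "\<dots> = real n / (real n + 1) * cmod (poly (vieta_poly n z) t)"
      using E1 by (simp add: \<eta>_def)
    finally have le: "cmod (poly (vieta_poly n w) t - poly (vieta_poly n z) t) \<le> real n / (real n + 1) * cmod (poly (vieta_poly n z) t)" .
    have pos: "cmod (poly (vieta_poly n z) t) > 0"
      using z t mem_sym_product_iff[OF sym_product_extensional[OF z]] by simp
    show "poly (vieta_poly n w) t \<noteq> 0"
    proof
      assume "poly (vieta_poly n w) t = 0"
      with le pos show False by (simp add: field_simps)
    qed
  qed
  with \<eta>0 show ?thesis by blast
qed

subsection \<open>The Kobayashi pseudodistance\<close>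

text \<open>From \<open>ln y \<le> y - 1\<close> at \<open>y = (1 - x) / (1 + x)\<close>. It
  compares Euclidean Lipschitz bounds with the Poincare distance.\<close>

lemma artanh_ge_half:
  fixes x :: real
  assumes "0 \<le> x" "x < 1"
  shows "x / 2 \<le> artanh x"
proof -
  have "ln ((1 - x) / (1 + x)) \<le> (1 - x) / (1 + x) - 1" using assms by (intro ln_le_minus_one) auto
  also have "\<dots> = - (2 * (x / (1 + x)))" using assms by (simp add: field_simps)
  finally have "2 * (x / (1 + x)) \<le> - ln ((1 - x) / (1 + x))" by simp
  also have "\<dots> = ln ((1 + x) / (1 - x))" using assms by (simp add: ln_div)
  finally have 1: "x / (1 + x) \<le> artanh x" unfolding artanh_def by linarith
  have "x * x \<le> 1 * x" using assms by (intro mult_right_mono) auto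
  then have "x / 2 \<le> x / (1 + x)" using assms by (simp add: field_simps)
  with 1 show ?thesis by linarith
qed

lemma poincare_dist_0: "poincare_dist 0 \<sigma> = artanh (cmod \<sigma>)"
  by (simp add: poincare_dist_def)

lemma below_lempert_le:
  assumes d: "below_lempert n \<Omega> d" and f: "f \<in> holomorphic_maps n (ball 0 1) \<Omega>" and \<sigma>: "cmod \<sigma> < 1"
  shows "d (f 0) (f \<sigma>) \<le> artanh (cmod \<sigma>)"
proof -
  have mem: "f 0 \<in> \<Omega>" "f \<sigma> \<in> \<Omega>" using f \<sigma> by (auto simp: holomorphic_maps_def)
  have "lempert n \<Omega> (f 0) (f \<sigma>) \<le> ereal (poincare_dist 0 \<sigma>)"
    unfolding lempert_def using f \<sigma> by (intro INF_lower) auto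
  then have "ereal (d (f 0) (f \<sigma>)) \<le> ereal (poincare_dist 0 \<sigma>)"
    using d mem unfolding below_lempert_def by (meson order_trans)
  then show ?thesis by (simp add: poincare_dist_0)
qed

text \<open>The truncation makes an estimate on small discs sufficient.\<close>

lemma below_lempert_truncated:
  fixes \<Phi> :: "cvec \<Rightarrow> 'm::metric_space"
  assumes \<epsilon>: "0 < \<epsilon>" and B: "0 < B"
    and lip: "\<And>f \<sigma>. f \<in> holomorphic_maps n (ball 0 1) \<Omega> \<Longrightarrow> cmod \<sigma> \<le> \<epsilon> \<Longrightarrow> cmod \<sigma> < 1 \<Longrightarrow>
       dist (\<Phi> (f 0)) (\<Phi> (f \<sigma>)) \<le> B * cmod \<sigma>"
  shows "below_lempert n \<Omega> (\<lambda>w z. min (\<epsilon> / 2) (dist (\<Phi> w) (\<Phi> z) / (2 * B)))"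
  unfolding below_lempert_def
proof (intro conjI ballI)
  have triangle: "min (\<epsilon> / 2) (dist (\<Phi> x) (\<Phi> z) / (2 * B))
      \<le> min (\<epsilon> / 2) (dist (\<Phi> x) (\<Phi> y) / (2 * B)) + min (\<epsilon> / 2) (dist (\<Phi> y) (\<Phi> z) / (2 * B))" for x y z
  proof -
    have "dist (\<Phi> x) (\<Phi> z) / (2 * B) \<le> (dist (\<Phi> x) (\<Phi> y) + dist (\<Phi> y) (\<Phi> z)) / (2 * B)"
      using B by (intro divide_right_mono dist_triangle) auto
    then have "dist (\<Phi> x) (\<Phi> z) / (2 * B) \<le> dist (\<Phi> x) (\<Phi> y) / (2 * B) + dist (\<Phi> y) (\<Phi> z) / (2 * B)"
      by (simp add: add_divide_distrib)
    moreover have "0 \<le> dist (\<Phi> x) (\<Phi> y) / (2 * B)" "0 \<le> dist (\<Phi> y) (\<Phi> z) / (2 * B)" using B by auto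
    ultimately show ?thesis using \<epsilon> by linarith
  qed
  show "pseudodistance_on \<Omega> (\<lambda>w z. min (\<epsilon> / 2) (dist (\<Phi> w) (\<Phi> z) / (2 * B)))"
    unfolding pseudodistance_on_def
    by (intro conjI ballI allI triangle) (use \<epsilon> B in \<open>auto simp: dist_commute\<close>)
next
  fix w z
  show "ereal (min (\<epsilon> / 2) (dist (\<Phi> w) (\<Phi> z) / (2 * B))) \<le> lempert n \<Omega> w z"
    unfolding lempert_def
  proof (rule INF_greatest)
    fix \<sigma> assume "\<sigma> \<in> {\<sigma> \<in> ball 0 1. \<exists>f\<in>holomorphic_maps n (ball 0 1) \<Omega>. f 0 = w \<and> f \<sigma> = z}"
    then obtain f where f: "f \<in> holomorphic_maps n (ball 0 1) \<Omega>" "f 0 = w" "f \<sigma> = z" and \<sigma>: "cmod \<sigma> < 1" by auto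
    \<comment> \<open>Outside radius \<open>\<epsilon>\<close> the truncation level
      \<open>\<epsilon> / 2\<close> is already below \<open>cmod \<sigma> / 2\<close>.\<close>
    have "min (\<epsilon> / 2) (dist (\<Phi> w) (\<Phi> z) / (2 * B)) \<le> cmod \<sigma> / 2"
    proof (cases "cmod \<sigma> \<le> \<epsilon>")
      case True
      then have "dist (\<Phi> w) (\<Phi> z) / (2 * B) \<le> B * cmod \<sigma> / (2 * B)"
        using lip[OF f(1) True \<sigma>] f B by (intro divide_right_mono) auto
      then show ?thesis using B by simp
    qed auto
    also have "\<dots> \<le> poincare_dist 0 \<sigma>" unfolding poincare_dist_0 by (rule artanh_ge_half) (use \<sigma> in auto)
    finally show "ereal (min (\<epsilon> / 2) (dist (\<Phi> w) (\<Phi> z) / (2 * B))) \<le> ereal (poincare_dist 0 \<sigma>)" by (simp only: ereal_less_eq)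
  qed
qed

section \<open>Existence of the Kobayashi pseudodistance and its behaviour on discs\<close>

lemma holomorphic_elem_sym_update:
  assumes "g holomorphic_on S"
  shows "(\<lambda>\<zeta>. elem_sym n j (l(i := g \<zeta>))) holomorphic_on S"
proof -
  have "(\<lambda>\<zeta>. (l(i := g \<zeta>)) k) holomorphic_on S" for k
    using assms by (cases "k = i") auto
  then show ?thesis unfolding elem_sym_def by (intro holomorphic_intros)
qed

text \<open>Admitting a bound uniform in \<open>d\<close> is an equivalence relation between
  positions of the moving root. Small discs in that root make it hold locally, and \<open>D\<close>
  is connected.\<close>

lemma below_lempert_bounded_update:
  assumes D: "open D" "connected D" and l: "l \<in> {1..n} \<rightarrow>\<^sub>E D" and i: "i \<in> {1..n}" and xy: "x \<in> D" "y \<in> D"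
  shows "\<exists>B. \<forall>d. below_lempert n (sym_product n D) d \<longrightarrow>
     d (symmetrization n (l(i := x))) (symmetrization n (l(i := y))) \<le> B"
proof (rule connected_equivalence_relation[OF D(2) xy])
  let ?\<Omega> = "sym_product n D" and ?p = "\<lambda>x. symmetrization n (l(i := x))"
  have mem: "?p x \<in> ?\<Omega>" if "x \<in> D" for x
    using l i that unfolding sym_product_def by (intro imageI) (auto simp: PiE_iff extensional_def)
  show "\<exists>B. \<forall>d. below_lempert n ?\<Omega> d \<longrightarrow> d (?p y) (?p x) \<le> B"
    if "\<exists>B. \<forall>d. below_lempert n ?\<Omega> d \<longrightarrow> d (?p x) (?p y) \<le> B" for x y
    using that by (auto simp: below_lempert_def pseudodistance_on_def)
  show "\<exists>B. \<forall>d. below_lempert n ?\<Omega> d \<longrightarrow> d (?p x) (?p z) \<le> B"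
    if ex: "\<exists>B. \<forall>d. below_lempert n ?\<Omega> d \<longrightarrow> d (?p x) (?p y) \<le> B"
      "\<exists>B. \<forall>d. below_lempert n ?\<Omega> d \<longrightarrow> d (?p y) (?p z) \<le> B" and D: "x \<in> D" "y \<in> D" "z \<in> D" for x y z
  proof -
    obtain B B' where B: "\<And>d. below_lempert n ?\<Omega> d \<Longrightarrow> d (?p x) (?p y) \<le> B"
      "\<And>d. below_lempert n ?\<Omega> d \<Longrightarrow> d (?p y) (?p z) \<le> B'" using ex by blast
    have "d (?p x) (?p z) \<le> B + B'" if d: "below_lempert n ?\<Omega> d" for d
    proof -
      have "d (?p x) (?p z) \<le> d (?p x) (?p y) + d (?p y) (?p z)"
        using d mem[OF D(1)] mem[OF D(2)] mem[OF D(3)] unfolding below_lempert_def pseudodistance_on_def by blast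
      then show ?thesis using B[OF d] by linarith
    qed
    then show ?thesis by blast
  qed
  fix a assume "a \<in> D"
  then obtain r where r: "r > 0" "ball a r \<subseteq> D" using D(1) by (auto simp: open_contains_ball)
  have "\<exists>B. \<forall>d. below_lempert n ?\<Omega> d \<longrightarrow> d (?p a) (?p b) \<le> B" if b: "b \<in> ball a r" for b
  proof -
    define f where "f \<zeta> = ?p (a + of_real r * \<zeta>)" for \<zeta>
    have "f \<in> holomorphic_maps n (ball 0 1) ?\<Omega>"
      unfolding holomorphic_maps_def
    proof (intro CollectI conjI ballI)
      fix z :: complex assume "z \<in> ball 0 1"
      then have "a + of_real r * z \<in> ball a r" using r by (simp add: dist_norm norm_mult)
      then show "f z \<in> ?\<Omega>" unfolding f_def using r by (intro mem) auto
    next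
      fix j assume "j \<in> {1..n}"
      then show "(\<lambda>z. f z j) holomorphic_on ball 0 1"
        by (simp add: f_def symmetrization_def) (intro holomorphic_elem_sym_update holomorphic_intros)
    qed
    moreover have "cmod ((b - a) / of_real r) < 1"
      using b r by (simp add: norm_divide dist_norm norm_minus_commute)
    ultimately have "d (f 0) (f ((b - a) / of_real r)) \<le> artanh (cmod ((b - a) / of_real r))"
      if "below_lempert n ?\<Omega> d" for d
      using below_lempert_le that by blast
    moreover have "f 0 = ?p a" "f ((b - a) / of_real r) = ?p b" using r by (auto simp: f_def)
    ultimately show ?thesis by auto
  qed
  then show "\<exists>T. openin (top_of_set D) T \<and> a \<in> T \<and>
      (\<forall>x\<in>T. \<exists>B. \<forall>d. below_lempert n ?\<Omega> d \<longrightarrow> d (?p a) (?p x) \<le> B)"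
    using r D(1) by (intro exI[of _ "ball a r"]) (auto simp: openin_open_eq)
qed

text \<open>Roots are moved one at a time. This is the condition under which
  \<open>kobayashi\<close> is indeed the largest pseudodistance.\<close>

lemma below_lempert_bounded:
  assumes D: "open D" "connected D" and w: "w \<in> sym_product n D" and z: "z \<in> sym_product n D"
  shows "\<exists>B. \<forall>d. below_lempert n (sym_product n D) d \<longrightarrow> d w z \<le> B"
proof -
  let ?\<Omega> = "sym_product n D"
  obtain l m where l: "l \<in> {1..n} \<rightarrow>\<^sub>E D" "w = symmetrization n l" and m: "m \<in> {1..n} \<rightarrow>\<^sub>E D" "z = symmetrization n m"
    using w z by (auto simp: sym_product_def)
  define h where "h k = (\<lambda>i. if i \<le> k then m i else l i)" for k :: nat
  have h: "h k \<in> {1..n} \<rightarrow>\<^sub>E D" for k using l m by (auto simp: h_def PiE_iff extensional_def)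
  have hsym: "symmetrization n (h k) \<in> ?\<Omega>" for k using h by (auto simp: sym_product_def)
  have "\<exists>B. \<forall>d. below_lempert n ?\<Omega> d \<longrightarrow> d w (symmetrization n (h k)) \<le> B" if "k \<le> n" for k
    using that
  proof (induction k)
    case 0
    have "h 0 = l" using l m by (auto simp: h_def PiE_iff extensional_def fun_eq_iff)
    then have "d w (symmetrization n (h 0)) \<le> 0" if "below_lempert n ?\<Omega> d" for d
      using that w l by (auto simp: below_lempert_def pseudodistance_on_def)
    then show ?case by blast
  next
    case (Suc k)
    then obtain B where B: "\<And>d. below_lempert n ?\<Omega> d \<Longrightarrow> d w (symmetrization n (h k)) \<le> B" by auto
    have k: "Suc k \<in> {1..n}" using Suc.prems by auto
    have eq: "(h k)(Suc k := l (Suc k)) = h k" "(h k)(Suc k := m (Suc k)) = h (Suc k)"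
      by (auto simp: h_def fun_eq_iff le_Suc_eq)
    have "l (Suc k) \<in> D" "m (Suc k) \<in> D" using l m k by (auto simp: PiE_iff)
    from below_lempert_bounded_update[OF D h[of k] k this, unfolded eq]
    obtain B' where B': "\<And>d. below_lempert n ?\<Omega> d \<Longrightarrow> d (symmetrization n (h k)) (symmetrization n (h (Suc k))) \<le> B'"
      by blast
    have "d w (symmetrization n (h (Suc k))) \<le> B + B'" if d: "below_lempert n ?\<Omega> d" for d
    proof -
      have "d w (symmetrization n (h (Suc k))) \<le> d w (symmetrization n (h k)) + d (symmetrization n (h k)) (symmetrization n (h (Suc k)))"
        using d w hsym unfolding below_lempert_def pseudodistance_on_def by blast
      then show ?thesis using B[OF d] B'[OF d] by linarith
    qed
    then show ?case by blast
  qed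
  moreover have "h n = m" using l m by (auto simp: h_def PiE_iff extensional_def fun_eq_iff)
  ultimately show ?thesis using m by (metis order_refl)
qed

lemma is_kobayashi_sym_product:
  assumes "open D" "connected D"
  shows "is_kobayashi n (sym_product n D) (kobayashi n (sym_product n D))"
  by (rule is_kobayashi_kobayashi) (rule below_lempert_bounded[OF assms])

text \<open>The affine disc through \<open>z\<close> and a nearby point stays in the polydisc from
  \<open>sym_product_nbhd\<close> and reaches that point at a small parameter.\<close>

lemma kobayashi_tendsto_0:
  assumes D: "open D" and k: "below_lempert n (sym_product n D) k" and z: "z \<in> sym_product n D"
    and w: "\<And>m. w m \<in> sym_product n D" and lim: "\<And>j. j \<in> {1..n} \<Longrightarrow> (\<lambda>m. w m j) \<longlonglongrightarrow> z j"
  shows "(\<lambda>m. k (w m) z) \<longlonglongrightarrow> 0"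
proof (rule LIMSEQ_I)
  fix e :: real assume e: "0 < e"
  let ?\<Omega> = "sym_product n D"
  have k0: "0 \<le> k x y" "k x y = k y x" for x y using k by (auto simp: below_lempert_def pseudodistance_on_def)
  obtain \<eta> where \<eta>: "\<eta> > 0" "\<And>x. x \<in> extensional {1..n} \<Longrightarrow> (\<And>j. j \<in> {1..n} \<Longrightarrow> cmod (x j - z j) \<le> \<eta>) \<Longrightarrow> x \<in> ?\<Omega>"
    using sym_product_nbhd[OF D z] by metis
  \<comment> \<open>Chosen so that \<open>artanh s = e / 2\<close>; the disc \<open>f\<close> below
    reaches \<open>w m\<close> at \<open>s\<close>.\<close>
  define s where "s = tanh (e / 2)"
  have s: "0 < s" "s < 1" using e by (auto simp: s_def tanh_real_lt_1)
  have close: "k (w m) z < e" if m: "\<forall>j\<in>{1..n}. cmod (w m j - z j) < \<eta> * s" for m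
  proof -
    define f where "f \<zeta> = (\<lambda>j\<in>{1..n}. z j + \<zeta> * ((w m j - z j) / of_real s))" for \<zeta>
    have "f \<in> holomorphic_maps n (ball 0 1) ?\<Omega>"
      unfolding holomorphic_maps_def
    proof (intro CollectI conjI ballI)
      fix \<zeta> :: complex assume \<zeta>: "\<zeta> \<in> ball 0 1"
      show "f \<zeta> \<in> ?\<Omega>"
      proof (rule \<eta>(2))
        fix j assume j: "j \<in> {1..n}"
        have "cmod (w m j - z j) / s \<le> \<eta>" using m j s by (simp add: divide_le_eq less_imp_le)
        then have "cmod \<zeta> * (cmod (w m j - z j) / s) \<le> 1 * \<eta>" using \<zeta> s by (intro mult_mono) auto
        then show "cmod (f \<zeta> j - z j) \<le> \<eta>" using j s by (simp add: f_def norm_mult norm_divide)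
      qed (simp add: f_def)
    next
      fix j assume "j \<in> {1..n}"
      then show "(\<lambda>\<zeta>. f \<zeta> j) holomorphic_on ball 0 1"
        using s by (simp add: f_def) (intro holomorphic_intros, auto)
    qed
    moreover have "f 0 = z"
      using sym_product_extensional[OF z] by (auto simp: f_def fun_eq_iff extensional_def)
    moreover have "f (of_real s) = w m"
      using sym_product_extensional[OF w] s by (auto simp: f_def fun_eq_iff extensional_def)
    ultimately have "k z (w m) \<le> artanh (cmod (of_real s))"
      using below_lempert_le[OF k, of f "of_real s"] s by auto
    also have "\<dots> = e / 2" using s by (simp add: s_def artanh_tanh_real)
    finally show ?thesis using e k0(2)[of z] by simp
  qed
  have "\<forall>\<^sub>F m in sequentially. \<forall>j\<in>{1..n}. cmod (w m j - z j) < \<eta> * s"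
  proof (intro eventually_ball_finite ballI)
    fix j assume "j \<in> {1..n}"
    then show "\<forall>\<^sub>F m in sequentially. cmod (w m j - z j) < \<eta> * s"
      using lim \<eta> s unfolding tendsto_iff dist_norm by simp
  qed simp
  then obtain N where "\<And>m. m \<ge> N \<Longrightarrow> \<forall>j\<in>{1..n}. cmod (w m j - z j) < \<eta> * s"
    by (auto simp: eventually_sequentially)
  then have "\<And>m. m \<ge> N \<Longrightarrow> norm (k (w m) z - 0) < e" using close k0(1) by (metis abs_of_nonneg diff_zero real_norm_def)
  then show "\<exists>N. \<forall>m\<ge>N. norm (k (w m) z - 0) < e" by blast
qed

text \<open>After rescaling the variable, the point \<open>f z\<close> is reached at an arbitrarily
  small parameter \<open>s\<close>.\<close>

lemma kobayashi_zero_on_entire_curve: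
  assumes k: "below_lempert n \<Omega> k" and f: "f \<in> holomorphic_maps n UNIV \<Omega>"
  shows "k (f 0) (f z) = 0"
proof -
  have "k (f 0) (f z) \<le> e" if e: "e > 0" for e
  proof -
    define s where "s = tanh e"
    have s: "0 < s" "s < 1" using e by (auto simp: s_def tanh_real_lt_1)
    define g where "g \<zeta> = f (\<zeta> * (z / of_real s))" for \<zeta>
    have "g \<in> holomorphic_maps n (ball 0 1) \<Omega>"
      unfolding holomorphic_maps_def
    proof (intro CollectI conjI ballI)
      fix \<zeta> show "g \<zeta> \<in> \<Omega>" using f by (auto simp: g_def holomorphic_maps_def)
    next
      fix j assume "j \<in> {1..n}"
      then have "(\<lambda>z. f z j) holomorphic_on UNIV" using f by (auto simp: holomorphic_maps_def)
      from holomorphic_on_compose_gen[OF _ this, of "\<lambda>\<zeta>. \<zeta> * (z / of_real s)" "ball 0 1"]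
      show "(\<lambda>\<zeta>. g \<zeta> j) holomorphic_on ball 0 1"
        using s by (simp add: g_def o_def holomorphic_intros)
    qed
    from below_lempert_le[OF k this, of "of_real s"] s
    have "k (g 0) (g (of_real s)) \<le> artanh s" by simp
    then show ?thesis using s by (simp add: g_def s_def artanh_tanh_real)
  qed
  then have "k (f 0) (f z) \<le> 0" by (rule field_le_epsilon) simp
  moreover have "0 \<le> k (f 0) (f z)" using k by (auto simp: below_lempert_def pseudodistance_on_def)
  ultimately show ?thesis by simp
qed

section \<open>Entire curves when few points are missing\<close>

text \<open>At each point of \<open>A\<close> exactly one of \<open>p\<close> and \<open>q\<close>
  vanishes, and \<open>exp\<close> has no zeros, so \<open>p + smult (exp \<zeta>) q\<close> has no
  zero in \<open>A\<close>.\<close>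

lemma entire_curve_sym_product:
  assumes n: "0 < n" and D: "finite (- D)" "card (- D) < 2 * n"
  shows "\<exists>f\<in>holomorphic_maps n UNIV (sym_product n D). \<not> f constant_on UNIV"
proof -
  have "infinite D" using D(1) infinite_UNIV_char_0[where 'a = complex] by (metis Compl_partition finite_Un)
  \<comment> \<open>Points of \<open>D\<close> pad the missing ones to exactly
    \<open>2 * n - 1\<close>, which then split into \<open>n\<close> and
    \<open>n - 1\<close>.\<close>
  then obtain X where X: "X \<subseteq> D" "finite X" "card X = 2 * n - 1 - card (- D)" using infinite_arbitrarily_large by blast
  define A where "A = X \<union> - D"
  have "card A = card X + card (- D)" unfolding A_def using X D by (intro card_Un_disjoint) auto
  then have A: "finite A" "card A = 2 * n - 1" "- D \<subseteq> A"
    using X D by (auto simp: A_def)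
  have "n \<le> card A" using A(2) n by simp
  then obtain B where B: "B \<subseteq> A" "card B = n" by (rule obtain_subset_with_card_n)
  define p where "p = (\<Prod>b\<in>B. [:- b, 1:])"
  define q where "q = (\<Prod>b\<in>A - B. [:- b, 1:])"
  have cAB: "card (A - B) = n - 1" using A B by (simp add: card_Diff_subset finite_subset)
  have dp: "degree p = n" "coeff p n = 1"
    unfolding p_def using degree_linear_prod[of "\<lambda>b. b" B] coeff_linear_prod[of "\<lambda>b. b" B] B(2) by auto
  have dq: "degree q = n - 1" "coeff q (n - 1) = 1"
    unfolding q_def using degree_linear_prod[of "\<lambda>b. b" "A - B"] coeff_linear_prod[of "\<lambda>b. b" "A - B"] cAB by auto
  define f where "f \<zeta> = (\<lambda>j\<in>{1..n}. (-1) ^ j * coeff (p + smult (exp \<zeta>) q) (n - j))" for \<zeta>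
  have vf: "vieta_poly n (f \<zeta>) = p + smult (exp \<zeta>) q" for \<zeta>
    unfolding f_def
  proof (rule vieta_poly_coeffs)
    show "degree (p + smult (exp \<zeta>) q) \<le> n"
      using dp dq by (intro degree_add_le) auto
    show "coeff (p + smult (exp \<zeta>) q) n = 1" using dp dq n by (simp add: coeff_eq_0)
  qed
  have "poly (vieta_poly n (f \<zeta>)) a \<noteq> 0" if a: "a \<in> A" for \<zeta> a
  proof -
    have finB: "finite B" using A B finite_subset by blast
    have "poly p a = 0 \<longleftrightarrow> a \<in> B" "poly q a = 0 \<longleftrightarrow> a \<in> A - B"
      unfolding p_def q_def poly_linear_prod[of "\<lambda>b. b"] using finB A(1) by (auto simp: prod_zero_iff)
    then show ?thesis using a by (auto simp: vf)
  qed
  then have "f \<zeta> \<in> sym_product n D" for \<zeta>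
    using A(3) by (subst mem_sym_product_iff) (auto simp: f_def)
  moreover have "(\<lambda>\<zeta>. f \<zeta> j) holomorphic_on UNIV" if "j \<in> {1..n}" for j
    using that by (simp add: f_def) (intro holomorphic_intros)
  ultimately have "f \<in> holomorphic_maps n UNIV (sym_product n D)" by (simp add: holomorphic_maps_def)
  moreover have "\<not> f constant_on UNIV"
  proof
    assume "f constant_on UNIV"
    then have "f 0 = f 1" by (auto simp: constant_on_def)
    then have "exp 0 * coeff q (n - 1) = exp 1 * coeff q (n - 1)"
      using vf[of 0] vf[of 1] by (metis add_left_cancel coeff_smult)
    then have "exp (1::complex) = 1" unfolding dq(2) by simp
    then have "exp (1::real) = 1" by (metis exp_of_real of_real_1 of_real_eq_1_iff)
    then show False by simp
  qed
  ultimately show ?thesis by blast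
qed

subsection \<open>Completeness\<close>

lemma cmod_exp_diff_le:
  assumes "Re a \<le> M" "Re b \<le> M"
  shows "cmod (exp a - exp b) \<le> exp M * cmod (a - b)"
proof (rule field_differentiable_bound[of "{z. Re z \<le> M}" exp exp])
  show "convex {z. Re z \<le> M}" by (rule convex_halfspace_Re_le)
qed (use assms in \<open>auto intro: DERIV_exp has_field_derivative_at_within\<close>)

lemma height_perturb:
  assumes J: "finite J" "J \<noteq> {}" and "\<And>j. j \<in> J \<Longrightarrow> \<bar>x j - y j\<bar> \<le> e"
  shows "\<bar>height J x - height J y\<bar> \<le> e"
proof -
  have "height J x \<le> height J y + e" if "\<And>j. j \<in> J \<Longrightarrow> \<bar>x j - y j\<bar> \<le> e" for x y
  proof (rule height_le[OF J])
    fix j assume "j \<in> J"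
    then show "\<bar>x j\<bar> + 1 \<le> height J y + e"
      using abs_le_height[OF J(1), of j y] that[of j] by linarith
  qed
  from this[of x y] this[of y x] show ?thesis using assms(3) by (simp add: abs_minus_commute abs_le_iff)
qed

text \<open>Infinity contributes \<open>0\<close> to the maximum. When the values at
  \<open>A\<close> are nonzero, a bound on this quantity keeps them away from both 0 and
  infinity.\<close>

definition log_height :: "nat \<Rightarrow> complex set \<Rightarrow> cvec \<Rightarrow> real" where
  "log_height n A z = height (insert None (Some ` A)) (\<lambda>x. ln (cmod (value_at n z x)))"

lemma log_height_ge_1: "finite A \<Longrightarrow> 1 \<le> log_height n A z"
  unfolding log_height_def by (rule height_ge_1) auto

lemma exp_log_height_le:
  assumes A: "finite A" "a \<in> A" and nz: "poly (vieta_poly n z) a \<noteq> 0"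
  shows "exp (- log_height n A z) \<le> cmod (poly (vieta_poly n z) a)"
proof -
  have "\<bar>ln (cmod (value_at n z (Some a)))\<bar> + 1 \<le> log_height n A z"
    unfolding log_height_def using A by (intro abs_le_height) auto
  then have "- log_height n A z \<le> ln (cmod (poly (vieta_poly n z) a))" by simp
  then show ?thesis using nz by (simp add: ln_ge_iff)
qed

text \<open>The disc is contractible, so the zero-free values along \<open>f\<close> have
  logarithms, which form a dominated family by \<open>value_at_dominated\<close>. One
  \<open>B\<close> serves all discs.\<close>

lemma disc_logarithms:
  assumes A: "finite A" "card A = 2 * n" "A \<subseteq> - D"
  shows "\<exists>B\<ge>1. \<forall>f\<in>holomorphic_maps n (ball 0 1) (sym_product n D). \<exists>L.
     (\<forall>x\<in>insert None (Some ` A). \<forall>z\<in>ball 0 1. value_at n (f z) x = exp (L x z)) \<and>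
     (\<forall>x\<in>insert None (Some ` A). \<forall>\<sigma>. cmod \<sigma> \<le> 1/32 \<longrightarrow>
        cmod (L x \<sigma> - L x 0) \<le> B * log_height n A (f 0) * cmod \<sigma>)"
proof -
  define J where "J = insert None (Some ` A)"
  have J: "finite J" "card J = 2 * n + 1" "None \<in> J" using A by (auto simp: J_def card_image)
  obtain C where C: "C > 0" "\<And>z I j. I \<subseteq> J \<Longrightarrow> card I = n + 1 \<Longrightarrow> j \<in> J \<Longrightarrow>
      \<exists>i\<in>I. cmod (value_at n z j) \<le> C * cmod (value_at n z i)"
    using value_at_dominated[OF J(1)] by metis
  obtain B where B: "B \<ge> 1" and lip: "\<And>L j w. dominated_family n J (ball 0 1) (ln C) L \<Longrightarrow> (\<And>z. L None z = 0) \<Longrightarrow>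
      j \<in> J \<Longrightarrow> norm w \<le> 1/32 \<Longrightarrow> cmod (L j w - L j 0) \<le> B * height J (\<lambda>j. Re (L j 0)) * norm w"
    using log_family_Lipschitz[OF J, of "ln C"] by metis
  have "\<exists>L. (\<forall>x\<in>J. \<forall>z\<in>ball 0 1. value_at n (f z) x = exp (L x z)) \<and>
     (\<forall>x\<in>J. \<forall>\<sigma>. cmod \<sigma> \<le> 1/32 \<longrightarrow> cmod (L x \<sigma> - L x 0) \<le> B * log_height n A (f 0) * cmod \<sigma>)"
    if f: "f \<in> holomorphic_maps n (ball 0 1) (sym_product n D)" for f
  proof -
    have nz: "poly (vieta_poly n (f z)) a \<noteq> 0" if "a \<in> A" "z \<in> ball 0 1" for a z
      using f that A(3) mem_sym_product_iff[OF sym_product_extensional, of "f z"]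
      unfolding holomorphic_maps_def by blast
    have hol: "(\<lambda>z. poly (vieta_poly n (f z)) a) holomorphic_on ball 0 1" for a
      unfolding poly_vieta_poly using f by (intro holomorphic_intros) (auto simp: holomorphic_maps_def)
    have "\<exists>g. g holomorphic_on ball 0 1 \<and> (\<forall>z\<in>ball 0 1. poly (vieta_poly n (f z)) a = exp (g z))" if "a \<in> A" for a
      using contractible_imp_holomorphic_log[OF hol, of a] nz[OF that] convex_imp_contractible[OF convex_ball]
      by metis
    then obtain g where g: "\<And>a. a \<in> A \<Longrightarrow> g a holomorphic_on ball 0 1"
      "\<And>a z. a \<in> A \<Longrightarrow> z \<in> ball 0 1 \<Longrightarrow> poly (vieta_poly n (f z)) a = exp (g a z)" by metis
    \<comment> \<open>The zero logarithm at infinity is the vanishing member that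
      \<open>log_family_Lipschitz\<close> requires.\<close>
    define L where "L x = (case x of None \<Rightarrow> (\<lambda>z. 0) | Some a \<Rightarrow> g a)" for x
    have L: "value_at n (f z) x = exp (L x z)" if "x \<in> J" "z \<in> ball 0 1" for x z
      using that g by (auto simp: L_def J_def)
    have "dominated_family n J (ball 0 1) (ln C) L"
      unfolding dominated_family_def
    proof (intro conjI ballI allI impI)
      show "L j holomorphic_on ball 0 1" if "j \<in> J" for j
        using that g(1) by (auto simp: L_def J_def)
      fix z I j assume z: "z \<in> ball (0::complex) 1" and I: "I \<subseteq> J" "card I = n + 1" and j: "j \<in> J"
      obtain i where i: "i \<in> I" "cmod (value_at n (f z) j) \<le> C * cmod (value_at n (f z) i)" using C(2)[OF I j] by blast
      then have "exp (Re (L j z)) \<le> exp (Re (L i z) + ln C)"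
        using L[OF j z] L[of i z] z I C(1) by (auto simp: exp_add mult.commute)
      with i show "\<exists>i\<in>I. Re (L j z) \<le> Re (L i z) + ln C" by auto
    qed
    moreover have "height J (\<lambda>j. Re (L j 0)) = log_height n A (f 0)"
    proof -
      have "(\<lambda>x. \<bar>Re (L x 0)\<bar>) ` J = (\<lambda>x. \<bar>ln (cmod (value_at n (f 0) x))\<bar>) ` J"
        using L[of _ 0] by (intro image_cong) auto
      then show ?thesis by (simp add: log_height_def height_def J_def)
    qed
    ultimately have "cmod (L x \<sigma> - L x 0) \<le> B * log_height n A (f 0) * cmod \<sigma>" if "x \<in> J" "cmod \<sigma> \<le> 1/32" for x \<sigma>
      using lip[of L x \<sigma>] that by (simp add: L_def)
    with L show ?thesis by blast
  qed
  with B show ?thesis unfolding J_def by blast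
qed

text \<open>
  The first distance keeps Cauchy sequences away from the boundary, the others separate points.
\<close>

lemma Lipschitz_functions_sym_product:
  assumes A: "finite A" "card A = 2 * n" "A \<subseteq> - D"
  obtains \<epsilon> B where "0 < \<epsilon>" "0 < B"
    "below_lempert n (sym_product n D)
       (\<lambda>w z. min (\<epsilon> / 2) (dist (ln (log_height n A w)) (ln (log_height n A z)) / (2 * B)))"
    "\<And>a. a \<in> A \<Longrightarrow> below_lempert n (sym_product n D)
       (\<lambda>w z. min (\<epsilon> / 2) (dist (poly (vieta_poly n w) a * exp (- 2 * of_real (log_height n A w)))
                               (poly (vieta_poly n z) a * exp (- 2 * of_real (log_height n A z))) / (2 * B)))"
proof -
  define J where "J = insert None (Some ` A)"
  have J: "finite J" "J \<noteq> {}" using A by (auto simp: J_def)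
  let ?H = "holomorphic_maps n (ball 0 1) (sym_product n D)" and ?U = "log_height n A"
  obtain B where B: "B \<ge> 1" and lip: "\<And>f. f \<in> ?H \<Longrightarrow> \<exists>L. (\<forall>x\<in>J. \<forall>z\<in>ball 0 1. value_at n (f z) x = exp (L x z)) \<and>
     (\<forall>x\<in>J. \<forall>\<sigma>. cmod \<sigma> \<le> 1/32 \<longrightarrow> cmod (L x \<sigma> - L x 0) \<le> B * ?U (f 0) * cmod \<sigma>)"
    using disc_logarithms[OF A] unfolding J_def by blast
  \<comment> \<open>Makes \<open>e = B * cmod \<sigma>\<close> at most \<open>1/32\<close>, so the
    height at \<open>f \<sigma>\<close> is at least half of that at \<open>f 0\<close>.\<close>
  define \<epsilon> where "\<epsilon> = 1 / (32 * B)"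
  have \<epsilon>: "0 < \<epsilon>" "\<epsilon> \<le> 1/32" using B by (auto simp: \<epsilon>_def field_simps)
  have *: "dist (ln (?U (f 0))) (ln (?U (f \<sigma>))) \<le> 6 * B * cmod \<sigma> \<and>
     (\<forall>a\<in>A. dist (poly (vieta_poly n (f 0)) a * exp (- 2 * of_real (?U (f 0))))
                 (poly (vieta_poly n (f \<sigma>)) a * exp (- 2 * of_real (?U (f \<sigma>)))) \<le> 6 * B * cmod \<sigma>)"
    if f: "f \<in> ?H" and \<sigma>: "cmod \<sigma> \<le> \<epsilon>" for f \<sigma>
  proof -
    obtain L where L: "\<And>x z. x \<in> J \<Longrightarrow> z \<in> ball 0 1 \<Longrightarrow> value_at n (f z) x = exp (L x z)" and
      Llip: "\<And>x \<sigma>. x \<in> J \<Longrightarrow> cmod \<sigma> \<le> 1/32 \<Longrightarrow> cmod (L x \<sigma> - L x 0) \<le> B * ?U (f 0) * cmod \<sigma>"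
      using lip[OF f] by blast
    define U V e where "U = ?U (f 0)" and "V = ?U (f \<sigma>)" and "e = B * cmod \<sigma>"
    have \<sigma>1: "\<sigma> \<in> ball 0 1" and \<sigma>32: "cmod \<sigma> \<le> 1/32" using \<sigma> \<epsilon> by auto
    have e: "0 \<le> e" "e \<le> 1/32" using \<sigma> B by (auto simp: e_def \<epsilon>_def field_simps)
    have U1: "1 \<le> U" "1 \<le> V" using log_height_ge_1[OF A(1)] by (auto simp: U_def V_def)
    have Ldiff: "cmod (L x \<sigma> - L x 0) \<le> e * U" if "x \<in> J" for x
      using Llip[OF that \<sigma>32] by (simp add: e_def U_def mult_ac)
    have "\<bar>V - U\<bar> \<le> e * U"
      unfolding V_def U_def log_height_def J_def[symmetric]
    proof (rule height_perturb[OF J])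
      fix x assume x: "x \<in> J"
      have "ln (cmod (value_at n (f \<sigma>) x)) - ln (cmod (value_at n (f 0) x)) = Re (L x \<sigma> - L x 0)"
        using L[OF x \<sigma>1] L[OF x, of 0] by simp
      then show "\<bar>ln (cmod (value_at n (f \<sigma>) x)) - ln (cmod (value_at n (f 0) x))\<bar> \<le> e * height J (\<lambda>x. ln (cmod (value_at n (f 0) x)))"
        using Ldiff[OF x] abs_Re_le_cmod[of "L x \<sigma> - L x 0"] unfolding U_def log_height_def J_def by linarith
    qed
    moreover have "e * U \<le> 1/32 * U" using e U1 by (intro mult_right_mono) auto
    ultimately have V: "\<bar>V - U\<bar> \<le> e * U" "U / 2 \<le> V" by linarith+
    have "\<bar>ln U - ln V\<bar> \<le> 2 * e"
    proof -
      have "ln U - ln V \<le> (U - V) / V" "ln V - ln U \<le> (V - U) / U" using U1 by (auto intro: ln_diff_le)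
      moreover have "(U - V) / V \<le> 2 * e"
      proof -
        have "e * U \<le> e * (2 * V)" using V e by (intro mult_left_mono) auto
        then show ?thesis using V U1 by (simp add: divide_le_eq)
      qed
      moreover have "(V - U) / U \<le> 2 * e" using V U1 e by (simp add: divide_le_eq)
      ultimately show ?thesis by linarith
    qed
    then have "dist (ln U) (ln V) \<le> 6 * B * cmod \<sigma>" using e by (simp add: dist_real_def e_def)
    moreover have "dist (poly (vieta_poly n (f 0)) a * exp (- 2 * of_real U))
       (poly (vieta_poly n (f \<sigma>)) a * exp (- 2 * of_real V)) \<le> 6 * B * cmod \<sigma>" if a: "a \<in> A" for a
    proof -
      have aJ: "Some a \<in> J" using a by (simp add: J_def)
      \<comment> \<open>The Lipschitz bound for the logarithms contains the factor \<open>U\<close>.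
        Damping by twice the height pushes both exponents below \<open>- U / 2\<close> in real part,
        and the resulting exponential decay absorbs that factor.\<close>
      let ?p = "L (Some a) 0 - 2 * of_real U" and ?q = "L (Some a) \<sigma> - 2 * of_real V"
      have val: "poly (vieta_poly n (f z)) a = exp (L (Some a) z)" if "z \<in> ball 0 1" for z
        using L[OF aJ that] by simp
      have "\<bar>Re (L (Some a) z)\<bar> + 1 \<le> ?U (f z)" if "z \<in> ball 0 1" for z
        using abs_le_height[OF J(1) aJ, of "\<lambda>x. ln (cmod (value_at n (f z) x))"] val[OF that]
        by (simp add: log_height_def J_def)
      from this[of 0] this[OF \<sigma>1] have Re: "Re ?p \<le> - (U / 2)" "Re ?q \<le> - (U / 2)"
        using V U1 unfolding U_def[symmetric] V_def[symmetric] by auto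
      have "cmod (?p - ?q) \<le> cmod (L (Some a) \<sigma> - L (Some a) 0) + 2 * \<bar>V - U\<bar>"
      proof -
        have "?p - ?q = - (L (Some a) \<sigma> - L (Some a) 0) + of_real (2 * (V - U))" by simp
        also have "cmod \<dots> \<le> cmod (L (Some a) \<sigma> - L (Some a) 0) + cmod (of_real (2 * (V - U)))"
          by (metis norm_minus_cancel norm_triangle_ineq)
        finally show ?thesis by (simp only: norm_of_real abs_mult abs_numeral)
      qed
      also have "\<dots> \<le> e * U + 2 * (e * U)"
        by (intro add_mono mult_left_mono Ldiff[OF aJ] V) simp
      finally have pq: "cmod (?p - ?q) \<le> 3 * (e * U)" by (simp add: mult.commute)
      have "U \<le> 2 * exp (U / 2)" using exp_ge_add_one_self[of "U / 2"] by linarith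
      then have "exp (- (U / 2)) * U \<le> 2" by (simp add: exp_minus field_simps)
      have "cmod (exp ?p - exp ?q) \<le> exp (- (U / 2)) * cmod (?p - ?q)" by (rule cmod_exp_diff_le[OF Re])
      also have "\<dots> \<le> exp (- (U / 2)) * (3 * (e * U))" using pq by (intro mult_left_mono) auto
      also have "\<dots> = 3 * e * (exp (- (U / 2)) * U)" by simp
      also have "\<dots> \<le> 3 * e * 2" using \<open>exp (- (U / 2)) * U \<le> 2\<close> e by (intro mult_left_mono) auto
      finally have "cmod (exp ?p - exp ?q) \<le> 6 * B * cmod \<sigma>" by (simp add: e_def)
      moreover have "exp ?p = poly (vieta_poly n (f 0)) a * exp (- 2 * of_real U)"
        "exp ?q = poly (vieta_poly n (f \<sigma>)) a * exp (- 2 * of_real V)"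
        using val \<sigma>1 by (simp_all flip: exp_add)
      ultimately show ?thesis by (simp add: dist_norm)
    qed
    ultimately show ?thesis unfolding U_def V_def by blast
  qed
  show ?thesis
    by (rule that[of \<epsilon> "6 * B"]; (intro below_lempert_truncated)?)
       (use \<epsilon> B * in auto)
qed

lemma Cauchy_truncated:
  fixes \<Phi> :: "'c \<Rightarrow> 'm::metric_space"
  assumes M: "Metric_space M d" "Metric_space.MCauchy M d s" and "0 < c" "0 < B"
    and le: "\<And>w z. w \<in> M \<Longrightarrow> z \<in> M \<Longrightarrow> min c (dist (\<Phi> w) (\<Phi> z) / B) \<le> d w z"
  shows "Cauchy (\<lambda>m. \<Phi> (s m))"
proof (rule metric_CauchyI)
  fix e :: real assume e: "0 < e"
  have "0 < min c (e / B)" using assms e by simp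
  then obtain N where N: "\<forall>m l. N \<le> m \<longrightarrow> N \<le> l \<longrightarrow> d (s m) (s l) < min c (e / B)"
    using M(2) unfolding Metric_space.MCauchy_def[OF M(1)] by blast
  have "dist (\<Phi> (s m)) (\<Phi> (s l)) < e" if "N \<le> m" "N \<le> l" for m l
  proof -
    have "s m \<in> M" "s l \<in> M" using M(2) unfolding Metric_space.MCauchy_def[OF M(1)] by auto
    then have "min c (dist (\<Phi> (s m)) (\<Phi> (s l)) / B) < min c (e / B)" using le N that by (meson order_le_less_trans)
    then have "dist (\<Phi> (s m)) (\<Phi> (s l)) / B < e / B" by (simp add: min_def split: if_splits)
    then show ?thesis using \<open>0 < B\<close> by (simp add: divide_less_cancel)
  qed
  then show "\<exists>N. \<forall>m\<ge>N. \<forall>l\<ge>N. dist (\<Phi> (s m)) (\<Phi> (s l)) < e" by blast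
qed

text \<open>Distance 0 forces first the heights to agree, then, after cancelling the common
  exponential factor, the values on \<open>A\<close>; \<open>n\<close> of these determine the
  coordinates.\<close>

lemma kobayashi_separates:
  assumes k: "is_kobayashi n (sym_product n D) k" and A: "finite A" "card A = 2 * n" "A \<subseteq> - D"
    and wz: "w \<in> sym_product n D" "z \<in> sym_product n D" and zero: "k w z = 0"
  shows "w = z"
proof -
  obtain \<epsilon> B where \<epsilon>: "0 < \<epsilon>" "0 < B" and d1: "below_lempert n (sym_product n D)
       (\<lambda>w z. min (\<epsilon> / 2) (dist (ln (log_height n A w)) (ln (log_height n A z)) / (2 * B)))"
    and d2: "\<And>a. a \<in> A \<Longrightarrow> below_lempert n (sym_product n D)
       (\<lambda>w z. min (\<epsilon> / 2) (dist (poly (vieta_poly n w) a * exp (- 2 * of_real (log_height n A w)))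
                               (poly (vieta_poly n z) a * exp (- 2 * of_real (log_height n A z))) / (2 * B)))"
    using Lipschitz_functions_sym_product[OF A] by blast
  have below: "d w z \<le> 0" if "below_lempert n (sym_product n D) d" for d
    using k that wz zero unfolding is_kobayashi_def by metis
  have eq0: "x = y" if "min (\<epsilon> / 2) (dist x y / (2 * B)) \<le> 0" for x y :: "'x::metric_space"
    using that \<epsilon> by (auto simp: min_le_iff_disj divide_le_0_iff)
  have "ln (log_height n A w) = ln (log_height n A z)" using below[OF d1] by (rule eq0)
  then have U: "log_height n A w = log_height n A z"
    using log_height_ge_1[OF A(1), of n w] log_height_ge_1[OF A(1), of n z] by simp
  have val: "poly (vieta_poly n w) a = poly (vieta_poly n z) a" if "a \<in> A" for a
    using eq0[OF below[OF d2[OF that]]] U by simp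
  obtain A' where A': "A' \<subseteq> A" "card A' = n" "finite A'"
    using obtain_subset_with_card_n[of n A] A finite_subset by (metis le_add2 mult_2)
  obtain \<alpha> \<beta> where coord: "\<And>z j. j \<in> {1..n} \<Longrightarrow> z j = \<alpha> j + (\<Sum>a\<in>A'. \<beta> j a * poly (vieta_poly n z) a)"
    using coordinates_from_values[OF A'(3,2)] by metis
  show ?thesis
  proof (rule extensionalityI[OF sym_product_extensional[OF wz(1)] sym_product_extensional[OF wz(2)]])
    fix j assume j: "j \<in> {1..n}"
    have "(\<Sum>a\<in>A'. \<beta> j a * poly (vieta_poly n w) a) = (\<Sum>a\<in>A'. \<beta> j a * poly (vieta_poly n z) a)"
      using val A'(1) by (intro sum.cong) auto
    then show "w j = z j" unfolding coord[OF j, of w] coord[OF j, of z] by (rule arg_cong)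
  qed
qed

text \<open>The heights converge to a finite limit, so the damping factor can be removed and the
  values on \<open>A\<close> converge, hence the coordinates.\<close>

lemma kobayashi_Cauchy_converges:
  assumes k: "is_kobayashi n (sym_product n D) k" and A: "finite A" "card A = 2 * n" "A \<subseteq> - D"
    and M: "Metric_space (sym_product n D) k" "Metric_space.MCauchy (sym_product n D) k s"
  obtains z where "\<And>j. j \<in> {1..n} \<Longrightarrow> (\<lambda>m. s m j) \<longlonglongrightarrow> z j" "\<And>a. a \<in> A \<Longrightarrow> poly (vieta_poly n z) a \<noteq> 0"
proof -
  let ?U = "log_height n A"
  obtain \<epsilon> B where \<epsilon>: "0 < \<epsilon>" "0 < B" and d1: "below_lempert n (sym_product n D)
       (\<lambda>w z. min (\<epsilon> / 2) (dist (ln (?U w)) (ln (?U z)) / (2 * B)))"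
    and d2: "\<And>a. a \<in> A \<Longrightarrow> below_lempert n (sym_product n D)
       (\<lambda>w z. min (\<epsilon> / 2) (dist (poly (vieta_poly n w) a * exp (- 2 * of_real (?U w)))
                               (poly (vieta_poly n z) a * exp (- 2 * of_real (?U z))) / (2 * B)))"
    using Lipschitz_functions_sym_product[OF A] by blast
  have pos: "0 < \<epsilon> / 2" "0 < 2 * B" using \<epsilon> by auto
  have below: "d w z \<le> k w z"
    if "below_lempert n (sym_product n D) d" "w \<in> sym_product n D" "z \<in> sym_product n D" for d w z
    using k that unfolding is_kobayashi_def by blast
  have smem: "s m \<in> sym_product n D" for m
    using M(2) unfolding Metric_space.MCauchy_def[OF M(1)] by auto
  have "Cauchy (\<lambda>m. ln (?U (s m)))" by (rule Cauchy_truncated[OF M pos below[OF d1]])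
  then obtain u where "(\<lambda>m. ln (?U (s m))) \<longlonglongrightarrow> u" using Cauchy_convergent convergentD by blast
  then have "(\<lambda>m. exp (ln (?U (s m)))) \<longlonglongrightarrow> exp u" by (intro tendsto_intros)
  moreover have "exp (ln (?U z)) = ?U z" for z using log_height_ge_1[OF A(1), of n z] by simp
  ultimately have Ulim: "(\<lambda>m. ?U (s m)) \<longlonglongrightarrow> exp u" by simp
  have "\<exists>c. (\<lambda>m. poly (vieta_poly n (s m)) a) \<longlonglongrightarrow> c \<and> c \<noteq> 0" if a: "a \<in> A" for a
  proof -
    have "Cauchy (\<lambda>m. poly (vieta_poly n (s m)) a * exp (- 2 * of_real (?U (s m))))"
      by (rule Cauchy_truncated[OF M pos below[OF d2[OF a]]])
    then obtain c where c: "(\<lambda>m. poly (vieta_poly n (s m)) a * exp (- 2 * of_real (?U (s m)))) \<longlonglongrightarrow> c"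
      using Cauchy_convergent convergentD by blast
    have "(\<lambda>m. poly (vieta_poly n (s m)) a * exp (- 2 * of_real (?U (s m))) * exp (2 * of_real (?U (s m))))
        \<longlonglongrightarrow> c * exp (2 * of_real (exp u))"
      by (intro tendsto_intros c Ulim)
    then have lim: "(\<lambda>m. poly (vieta_poly n (s m)) a) \<longlonglongrightarrow> c * exp (2 * of_real (exp u))"
      by (simp add: mult.assoc flip: exp_add)
    have nz: "poly (vieta_poly n (s m)) a \<noteq> 0" for m
      using mem_sym_product_iff[OF sym_product_extensional[OF smem[of m]]] smem[of m] a A(3) by blast
    \<comment> \<open>The heights bound the values from below, and this lower bound has a positive
      limit.\<close>
    have "(\<lambda>m. exp (- ?U (s m))) \<longlonglongrightarrow> exp (- exp u)" by (intro tendsto_intros Ulim)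
    then have "exp (- exp u) \<le> cmod (c * exp (2 * of_real (exp u)))"
      by (rule LIMSEQ_le[OF _ tendsto_norm[OF lim]]) (use exp_log_height_le[OF A(1) a nz] in auto)
    then have "c * exp (2 * of_real (exp u)) \<noteq> 0" by (smt (verit) exp_gt_zero norm_zero)
    with lim show ?thesis by blast
  qed
  then obtain c where c: "\<And>a. a \<in> A \<Longrightarrow> (\<lambda>m. poly (vieta_poly n (s m)) a) \<longlonglongrightarrow> c a" "\<And>a. a \<in> A \<Longrightarrow> c a \<noteq> 0"
    by metis
  obtain A' where A': "A' \<subseteq> A" "card A' = n" "finite A'"
    using obtain_subset_with_card_n[of n A] A finite_subset by (metis le_add2 mult_2)
  obtain \<alpha> \<beta> where coord: "\<And>z j. j \<in> {1..n} \<Longrightarrow> z j = \<alpha> j + (\<Sum>a\<in>A'. \<beta> j a * poly (vieta_poly n z) a)"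
    using coordinates_from_values[OF A'(3,2)] by metis
  define z where "z j = \<alpha> j + (\<Sum>a\<in>A'. \<beta> j a * c a)" for j
  have lim: "(\<lambda>m. s m j) \<longlonglongrightarrow> z j" if j: "j \<in> {1..n}" for j
    unfolding coord[OF j, of "s _"] z_def using A'(1) by (intro tendsto_intros c(1)) auto
  have "poly (vieta_poly n z) a \<noteq> 0" if a: "a \<in> A" for a
  proof -
    have "(\<lambda>m. poly (vieta_poly n (s m)) a) \<longlonglongrightarrow> poly (vieta_poly n z) a"
      unfolding poly_vieta_poly by (intro tendsto_intros lim)
    from LIMSEQ_unique[OF this c(1)[OF a]] show ?thesis using c(2)[OF a] by simp
  qed
  with lim show ?thesis using that by blast
qed

lemma superset_card:
  assumes "infinite X \<or> m \<le> card X" "b \<in> X" "0 < m"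
  obtains A where "finite A" "card A = m" "A \<subseteq> X" "b \<in> A"
proof -
  have "infinite (X - {b}) \<or> m - 1 \<le> card (X - {b})" using assms by (auto simp: card_Diff_singleton)
  then obtain A where A: "A \<subseteq> X - {b}" "finite A" "card A = m - 1"
    by (metis infinite_arbitrarily_large obtain_subset_with_card_n)
  then have "b \<notin> A" by blast
  then show ?thesis by (intro that[of "insert b A"]) (use A assms in auto)
qed

text \<open>The coordinatewise limit does not depend on \<open>A\<close>. Choosing \<open>A\<close>
  through each missing point in turn shows that the polynomial of the limit has no zero outside
  \<open>D\<close>.\<close>

lemma kobayashi_complete_sym_product:
  assumes D: "open D" "connected D" and n: "0 < n" and card: "infinite (- D) \<or> 2 * n \<le> card (- D)"
  shows "kobayashi_complete n (sym_product n D)"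
proof -
  let ?\<Omega> = "sym_product n D"
  define k where "k = kobayashi n ?\<Omega>"
  have k: "is_kobayashi n ?\<Omega> k" unfolding k_def by (rule is_kobayashi_sym_product[OF D])
  then have kb: "below_lempert n ?\<Omega> k" by (simp add: is_kobayashi_def)
  have ext: "\<exists>A. finite A \<and> card A = 2 * n \<and> A \<subseteq> - D \<and> b \<in> A" if "b \<in> - D" for b
  proof -
    have "0 < 2 * n" using n by simp
    from superset_card[OF card that this] show ?thesis by metis
  qed
  have "- D \<noteq> {}" using card n by auto
  then obtain A where A: "finite A" "card A = 2 * n" "A \<subseteq> - D" using ext by blast
  have M: "Metric_space ?\<Omega> k"
  proof
    show "k x y = 0 \<longleftrightarrow> x = y" if "x \<in> ?\<Omega>" "y \<in> ?\<Omega>" for x y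
      using kobayashi_separates[OF k A that] kb that by (auto simp: below_lempert_def pseudodistance_on_def)
  qed (use kb in \<open>auto simp: below_lempert_def pseudodistance_on_def\<close>)
  interpret Metric_space ?\<Omega> k by (rule M)
  have mcomplete
    unfolding mcomplete_def
  proof (intro allI impI)
    fix s assume s: "MCauchy s"
    then have smem: "\<And>m. s m \<in> ?\<Omega>" unfolding MCauchy_def by auto
    obtain z where z: "\<And>j. j \<in> {1..n} \<Longrightarrow> (\<lambda>m. s m j) \<longlonglongrightarrow> z j"
      using kobayashi_Cauchy_converges[OF k A M s] by metis
    define y where "y = restrict z {1..n}"
    have "poly (vieta_poly n y) b \<noteq> 0" if "b \<in> - D" for b
    proof -
      obtain A where A: "finite A" "card A = 2 * n" "A \<subseteq> - D" "b \<in> A" using ext \<open>b \<in> - D\<close> by blast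
      obtain z' where z': "\<And>j. j \<in> {1..n} \<Longrightarrow> (\<lambda>m. s m j) \<longlonglongrightarrow> z' j" "poly (vieta_poly n z') b \<noteq> 0"
        using kobayashi_Cauchy_converges[OF k A(1-3) M s] A(4) by metis
      have "z' j = y j" if "j \<in> {1..n}" for j
        using LIMSEQ_unique[OF z'(1) z] that by (simp add: y_def)
      then have "vieta_poly n z' = vieta_poly n y" by (simp add: vieta_poly_def)
      then show ?thesis using z'(2) by simp
    qed
    then have y: "y \<in> ?\<Omega>" by (subst mem_sym_product_iff) (auto simp: y_def)
    have "(\<lambda>m. k (s m) y) \<longlonglongrightarrow> 0"
      by (rule kobayashi_tendsto_0[OF D(1) kb y smem]) (use z in \<open>simp add: y_def\<close>)
    then have "limitin mtopology s y sequentially"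
      unfolding limitin_metric_dist_null using y smem by simp
    then show "\<exists>x. limitin mtopology s x sequentially" by blast
  qed
  with M show ?thesis unfolding kobayashi_complete_def kobayashi_hyperbolic_def k_def by blast
qed

section \<open>Failure of hyperbolicity and the two cases\<close>

lemma not_hyperbolic_if_entire_curve:
  assumes k: "is_kobayashi n \<Omega> (kobayashi n \<Omega>)" and f: "f \<in> holomorphic_maps n UNIV \<Omega>" and nc: "\<not> f constant_on UNIV"
  shows "\<not> kobayashi_hyperbolic n \<Omega>"
proof
  assume "kobayashi_hyperbolic n \<Omega>"
  then interpret Metric_space \<Omega> "kobayashi n \<Omega>" by (simp add: kobayashi_hyperbolic_def)
  have "f z = f 0" for z
  proof -
    have "kobayashi n \<Omega> (f 0) (f z) = 0"
      using k f by (intro kobayashi_zero_on_entire_curve) (auto simp: is_kobayashi_def)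
    then show ?thesis using f zero[of "f 0" "f z"] by (simp add: holomorphic_maps_def)
  qed
  then show False using nc by (auto simp: constant_on_def)
qed

theorem theorem16:
  fixes D :: "complex set" and n :: nat
  assumes "open D" and "connected D" and "D \<noteq> {}" and "n \<ge> 2"
  shows "(infinite (- D) \<or> card (- D) \<ge> 2 * n \<longrightarrow> kobayashi_complete n (sym_product n D)) \<and>
         (finite (- D) \<and> card (- D) < 2 * n \<longrightarrow>
            (\<exists>f \<in> holomorphic_maps n UNIV (sym_product n D). \<not> f constant_on UNIV) \<and>
            \<not> kobayashi_hyperbolic n (sym_product n D))"
proof (intro conjI impI)
  have n: "0 < n" using assms(4) by simp
  show "kobayashi_complete n (sym_product n D)" if "infinite (- D) \<or> card (- D) \<ge> 2 * n"
    by (rule kobayashi_complete_sym_product[OF assms(1,2) n that])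
  assume "finite (- D) \<and> card (- D) < 2 * n"
  then show curve: "\<exists>f \<in> holomorphic_maps n UNIV (sym_product n D). \<not> f constant_on UNIV"
    by (intro entire_curve_sym_product[OF n]) auto
  then show "\<not> kobayashi_hyperbolic n (sym_product n D)"
    using not_hyperbolic_if_entire_curve[OF is_kobayashi_sym_product[OF assms(1,2)]] by blast
qed

end
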